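(* Let $\mathbb{P}$ be a translation-invariant Gibbs random field on $\mathbb{Z}^d$, $d\ge2$, which is non-uniformly exponentially $\varphi$-mixing. Let $0<\Lambda_1\le\Lambda_2$ and let $\lambda_{A_n}\in[\Lambda_1,\Lambda_2]$ be the parameters (one for each $n$ and each $n$-pattern $A_n$) of the exponential law for first occurrences described in the context. Then there exist, for each $n\ge 1$, a set $G_n\subset\Omega$ which is a union of cylinders $\mathcal{C}(A_n)$ of $n$-patterns, and strictly positive constants $B,b,C,c,\rho$ (independent of $n$) such that for any $n\ge1$ $$\mathbb{P}(G_n^c)\le Be^{-bn^d},$$ and for each $n$-pattern $A_n$ with $\mathcal{C}(A_n)\subset G_n$ $$\left|\ \mathbb{P}\left\{\mathbf{r}_n>\left(\frac{t}{\lambda_{A_n}\mathbb{P}(\mathcal{C}(A_n))}\right)^{1/d}\ \Big|\ \mathcal{C}(A_n)\right\}-e^{-t}\ \right|\le C\ \mathbb{P}(\mathcal{C}(A_n))^{\rho}\ e^{-ct}$$ for all $t>0$.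
   Context: Setting. $\mathcal{A}$ is a finite set, $\Omega=\mathcal{A}^{\mathbb{Z}^d}$ with the product topology and its Borel sigma-field, $\mathcal{S}$ is the set of (nonempty) finite subsets of $\mathbb{Z}^d$, $|\mathbf{x}|=\sum_i|x_i|$, $d(A,B)=\min\{|\mathbf{x}-\mathbf{y}|:\mathbf{x}\in A,\mathbf{y}\in B\}$ for $A,B\in\mathcal{S}$. $\sigma_V$ is the restriction of $\sigma$ to $V$, $\Omega_V=\mathcal{A}^V$, $\mathcal{F}_V$ is the sigma-field generated by $\sigma(\mathbf{x})$, $\mathbf{x}\in V$, and $(\tau_{\mathbf{x}}\sigma)(\mathbf{y})=\sigma(\mathbf{x}+\mathbf{y})$. Patterns. $C_n=[0,n]^d\cap\mathbb{Z}^d$; an $n$-pattern is an element $A_n\in\Omega_{C_n}$, with cylinder $\mathcal{C}(A_n)=\{\sigma:\sigma_{C_n}=A_n\}$. First occurrence: $\mathbf{t}_{A_n}(\sigma)$ is the minimal $k\in\mathbb{N}$ such that there is $\mathbf{x}\in\mathbb{Z}_+^d$ with $|\mathbf{x}|>0$, $0\le x_i\le k$ for all $i$, and $(\tau_{\mathbf{x}}\sigma)_{C_n}=A_n$ ($\infty$ if none). First repetition: $\mathbf{r}_n(\sigma)$ is the minimal $k\in\mathbb{N}$ such that there is $\mathbf{x}\in\mathbb{Z}_+^d$ with $|\mathbf{x}|>0$, $0\le x_i\le k$ for all $i$, and $(\tau_{\mathbf{x}}\sigma)_{C_n}=\sigma_{C_n}$ ($\infty$ if none). Parameters $\lambda_{A_n}$.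 For such $\mathbb{P}$ there exist strictly positive constants $C',c',\rho',\Lambda_1\le\Lambda_2$ such that for every $n$ and every $n$-pattern $A_n$ there is $\lambda_{A_n}\in[\Lambda_1,\Lambda_2]$ with $\left|\mathbb{P}\{\mathbf{t}_{A_n}>(t/(\lambda_{A_n}\mathbb{P}(\mathcal{C}(A_n))))^{1/d}\}-e^{-t}\right|\le C'\,\mathbb{P}(\mathcal{C}(A_n))^{\rho'}e^{-c't}$ for all $t>0$. The $\lambda_{A_n}$ in the claim are these. Gibbs fields. A translation-invariant interaction is $U:\mathcal{S}\times\Omega\to\mathbb{R}$ such that $U(A,\sigma)$ depends only on $\sigma_A$, $U(A+\mathbf{x},\tau_{-\mathbf{x}}\sigma)=U(A,\sigma)$, and $\sum_{A\ni 0}\sup_\sigma|U(A,\sigma)|<\infty$. Put $H^\zeta_\Lambda(\sigma)=\sum_{A\cap\Lambda\ne\emptyset}U(A,\sigma_\Lambda\zeta_{\Lambda^c})$. A translation-invariant Gibbs random field (with interaction $U$) is a translation-invariant probability measure $\mathbb{P}$ on $\Omega$ such that for every $\Lambda\in\mathcal{S}$ the conditional distribution of $\sigma_\Lambda$ given $\sigma_{\Lambda^c}=\zeta_{\Lambda^c}$ is, for $\mathbb{P}$-a.e. $\zeta$, proportional to $e^{-H^\zeta_\Lambda(\sigma)}$. Mixing. For $m>0$, $\varphi(m)=\sup\frac{1}{|A_1|}\left|\mathbb{P}(E_{A_1}\mid E_{A_2})-\mathbb{P}(E_{A_1})\right|$, the supremum over finite $A_1,A_2\subset\mathbb{Z}^d$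 with $d(A_1,A_2)\ge m$ and $E_{A_i}\in\mathcal{F}_{A_i}$ with $\mathbb{P}(E_{A_2})>0$. $\mathbb{P}$ is non-uniformly exponentially $\varphi$-mixing if there are $C_1,C_2>0$ with $\varphi(m)\le C_1e^{-C_2m}$ for all $m>0$. *)

theory Defs
  imports "HOL-Probability.Probability"
begin

type_synonym 'd site = "int ^ 'd"
type_synonym ('a, 'd) config = "int ^ 'd \<Rightarrow> 'a"

definition site_norm :: "('d::finite) site \<Rightarrow> int" where
  "site_norm x = (\<Sum>i\<in>UNIV. \<bar>x $ i\<bar>)"

definition finite_volumes :: "('d::finite) site set set" where
  "finite_volumes = {\<Lambda>. finite \<Lambda> \<and> \<Lambda> \<noteq> {}}"

definition volume_dist :: "('d::finite) site set \<Rightarrow> 'd site set \<Rightarrow> int" where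
  "volume_dist A B = Min ((\<lambda>(x, y). site_norm (x - y)) ` (A \<times> B))"

definition translate :: "('d::finite) site \<Rightarrow> ('a, 'd) config \<Rightarrow> ('a, 'd) config" where
  "translate x \<sigma> = (\<lambda>y. \<sigma> (x + y))"

definition config_space :: "('a::finite, 'd::finite) config measure" where
  "config_space = sigma UNIV {W. openin (product_topology (\<lambda>_. discrete_topology UNIV) UNIV) W}"

definition local_field :: "('d::finite) site set \<Rightarrow> ('a::finite, 'd) config measure" where
  "local_field V = sigma UNIV {(\<lambda>\<sigma>. \<sigma> x) -` B | x B. x \<in> V}"

text \<open>Elements of \<open>local_configs V\<close> are extensional functions, so that
  \<open>restrict \<sigma> V\<close> is the restriction of \<open>\<sigma>\<close> to \<open>V\<close>.\<close>

definition local_configs :: "('d::finite) site set \<Rightarrow> ('a::finite, 'd) config set" where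
  "local_configs V = (V \<rightarrow>\<^sub>E UNIV)"


subsection \<open>Patterns, occurrence and repetition times\<close>

definition cube :: "nat \<Rightarrow> ('d::finite) site set" where
  "cube n = {x. \<forall>i. 0 \<le> x $ i \<and> x $ i \<le> int n}"

definition patterns :: "nat \<Rightarrow> ('a::finite, 'd::finite) config set" where
  "patterns n = local_configs (cube n)"

definition cylinder :: "nat \<Rightarrow> ('a::finite, 'd::finite) config \<Rightarrow> ('a, 'd) config set" where
  "cylinder n A = {\<sigma>. restrict \<sigma> (cube n) = A}"

text \<open>In both times below the infimum is taken in \<^typ>\<open>enat\<close>: it is a minimum if the set is
  nonempty, and \<open>\<infinity>\<close> otherwise.\<close>

definition first_occurrence ::
    "nat \<Rightarrow> ('a::finite, 'd::finite) config \<Rightarrow> ('a, 'd) config \<Rightarrow> enat" where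
  "first_occurrence n A \<sigma> = Inf {enat k | k. \<exists>x. site_norm x > 0 \<and>
     (\<forall>i. 0 \<le> x $ i \<and> x $ i \<le> int k) \<and> restrict (translate x \<sigma>) (cube n) = A}"

definition first_repetition :: "nat \<Rightarrow> ('a::finite, 'd::finite) config \<Rightarrow> enat" where
  "first_repetition n \<sigma> = Inf {enat k | k. \<exists>x. site_norm x > 0 \<and>
     (\<forall>i. 0 \<le> x $ i \<and> x $ i \<le> int k) \<and>
     restrict (translate x \<sigma>) (cube n) = restrict \<sigma> (cube n)}"


subsection \<open>Gibbs random fields\<close>

text \<open>By the first clause each supremum is over a finite set of reals, hence a genuine one.\<close>

definition interaction :: "(('d::finite) site set \<Rightarrow> ('a::finite, 'd) config \<Rightarrow> real) \<Rightarrow> bool" where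
  "interaction U \<longleftrightarrow>
     (\<forall>A\<in>finite_volumes. \<forall>\<sigma> \<sigma>'. restrict \<sigma> A = restrict \<sigma>' A \<longrightarrow> U A \<sigma> = U A \<sigma>') \<and>
     (\<forall>A\<in>finite_volumes. \<forall>x \<sigma>. U ((\<lambda>y. y + x) ` A) (translate (- x) \<sigma>) = U A \<sigma>) \<and>
     (\<lambda>A. SUP \<sigma>. \<bar>U A \<sigma>\<bar>) summable_on {A \<in> finite_volumes. 0 \<in> A}"

definition glue :: "('d::finite) site set \<Rightarrow> ('a, 'd) config \<Rightarrow> ('a, 'd) config \<Rightarrow> ('a, 'd) config" where
  "glue \<Lambda> \<sigma> \<zeta> = (\<lambda>x. if x \<in> \<Lambda> then \<sigma> x else \<zeta> x)"

definition hamiltonian ::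
    "(('d::finite) site set \<Rightarrow> ('a::finite, 'd) config \<Rightarrow> real) \<Rightarrow>
     'd site set \<Rightarrow> ('a, 'd) config \<Rightarrow> ('a, 'd) config \<Rightarrow> real" where
  "hamiltonian U \<Lambda> \<zeta> \<sigma> =
     (\<Sum>\<^sub>\<infinity>A\<in>{A \<in> finite_volumes. A \<inter> \<Lambda> \<noteq> {}}. U A (glue \<Lambda> \<sigma> \<zeta>))"

definition translation_invariant :: "('a::finite, 'd::finite) config measure \<Rightarrow> bool" where
  "translation_invariant P \<longleftrightarrow> (\<forall>x. distr P P (translate x) = P)"

text \<open>The conditional distribution of the restriction to \<open>\<Lambda>\<close> lives on the finite set
  \<open>local_configs \<Lambda>\<close>, so it is given by the conditional probabilities, with respect to the
  sigma-field of the complement of \<open>\<Lambda>\<close>, of its points.\<close>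

definition gibbs_field ::
    "(('d::finite) site set \<Rightarrow> ('a::finite, 'd) config \<Rightarrow> real) \<Rightarrow>
     ('a, 'd) config measure \<Rightarrow> bool" where
  "gibbs_field U P \<longleftrightarrow>
     prob_space P \<and> sets P = sets config_space \<and> translation_invariant P \<and>
     (\<forall>\<Lambda>\<in>finite_volumes. AE \<zeta> in P. \<forall>\<xi>\<in>local_configs \<Lambda>.
        real_cond_exp P (local_field (- \<Lambda>)) (indicator {\<sigma>. restrict \<sigma> \<Lambda> = \<xi>}) \<zeta> =
          exp (- hamiltonian U \<Lambda> \<zeta> \<xi>) / (\<Sum>\<eta>\<in>local_configs \<Lambda>. exp (- hamiltonian U \<Lambda> \<zeta> \<eta>)))"


subsection \<open>Mixing\<close>

definition phi_mixing_coeff :: "('a::finite, 'd::finite) config measure \<Rightarrow> real \<Rightarrow> real" where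
  "phi_mixing_coeff P m =
     Sup {1 / real (card A\<^sub>1) *
            \<bar>\<P>(\<sigma> in P. \<sigma> \<in> E\<^sub>1 \<bar> \<sigma> \<in> E\<^sub>2) - measure P E\<^sub>1\<bar> | A\<^sub>1 A\<^sub>2 E\<^sub>1 E\<^sub>2.
          A\<^sub>1 \<in> finite_volumes \<and> A\<^sub>2 \<in> finite_volumes \<and> real_of_int (volume_dist A\<^sub>1 A\<^sub>2) \<ge> m \<and>
          E\<^sub>1 \<in> sets (local_field A\<^sub>1) \<and> E\<^sub>2 \<in> sets (local_field A\<^sub>2) \<and> measure P E\<^sub>2 > 0}"

definition exponentially_phi_mixing :: "('a::finite, 'd::finite) config measure \<Rightarrow> bool" where
  "exponentially_phi_mixing P \<longleftrightarrow>
     (\<exists>C\<^sub>1>0. \<exists>C\<^sub>2>0. \<forall>m>0. phi_mixing_coeff P m \<le> C\<^sub>1 * exp (- C\<^sub>2 * m))"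


subsection \<open>The exponential law for first occurrences\<close>

definition first_occurrence_law ::
    "('a::finite, 'd::finite) config measure \<Rightarrow> (nat \<Rightarrow> ('a, 'd) config \<Rightarrow> real) \<Rightarrow> real \<Rightarrow> real \<Rightarrow> bool" where
  "first_occurrence_law P lam \<Lambda>\<^sub>1 \<Lambda>\<^sub>2 \<longleftrightarrow>
     (\<exists>C>0. \<exists>c>0. \<exists>\<rho>>0. \<forall>n\<ge>1. \<forall>A\<in>patterns n.
        lam n A \<in> {\<Lambda>\<^sub>1..\<Lambda>\<^sub>2} \<and>
        (\<forall>t>0. \<bar>\<P>(\<sigma> in P. ereal_of_enat (first_occurrence n A \<sigma>) >
                     ereal ((t / (lam n A * measure P (cylinder n A))) powr (1 / real CARD('d))))
                 - exp (- t)\<bar>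
               \<le> C * measure P (cylinder n A) powr \<rho> * exp (- c * t)))"


subsection \<open>Consistency of the sigma-fields\<close>

lemma space_config_space [simp]: "space config_space = UNIV"
  by (simp add: config_space_def)

lemma space_local_field [simp]: "space (local_field V) = UNIV"
  by (simp add: local_field_def)

lemma openin_coordinate:
  "openin (product_topology (\<lambda>_. discrete_topology UNIV) UNIV) ((\<lambda>\<sigma>. \<sigma> x) -` B)"
proof -
  have "openin (product_topology (\<lambda>_. discrete_topology UNIV) UNIV)
          {\<sigma> \<in> topspace (product_topology (\<lambda>_. discrete_topology UNIV) UNIV). \<sigma> x \<in> B}"
    by (rule openin_continuous_map_preimage[OF continuous_map_product_projection]) auto
  then show ?thesis by (simp add: vimage_def)
qed

lemma coordinate_sets_config_space: "(\<lambda>\<sigma>. \<sigma> x) -` B \<in> sets config_space"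
  unfolding config_space_def by (simp add: sets_measure_of openin_coordinate sigma_sets.Basic)

lemma sets_config_space:
  "sets (config_space :: ('a::finite, 'd::finite) config measure) =
     sets (\<Pi>\<^sub>M x\<in>UNIV. count_space UNIV)"
proof
  let ?M = "\<Pi>\<^sub>M x\<in>(UNIV :: 'd site set). count_space (UNIV :: 'a set)"
  let ?T = "product_topology (\<lambda>_::'d site. discrete_topology (UNIV :: 'a set)) UNIV"
  have coord: "(\<lambda>\<sigma>. \<sigma> x) \<in> measurable ?M (count_space UNIV)" for x
    by (rule measurable_component_singleton) simp
  define K where "K = (\<lambda>l :: ('d site \<times> 'a) list. {\<sigma>. \<forall>(x, a)\<in>set l. \<sigma> x = a})"
  have K: "K l \<in> sets ?M" for l
  proof -
    have "K l = space ?M \<inter> (\<Inter>(x, a)\<in>set l. (\<lambda>\<sigma>. \<sigma> x) -` {a})"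
      by (auto simp: K_def space_PiM)
    moreover have "(\<lambda>\<sigma>. \<sigma> x) -` {a} \<in> sets ?M" for x a
      using measurable_sets[OF coord, of "{a}" x] by (simp add: space_PiM)
    ultimately show ?thesis
      by (cases "set l = {}") (auto intro!: sets.Int sets.finite_INT)
  qed
  have "W \<in> sets ?M" if "openin ?T W" for W
  proof -
    have "\<exists>l. \<sigma> \<in> K l \<and> K l \<subseteq> W" if "\<sigma> \<in> W" for \<sigma>
    proof -
      obtain V where V: "finite {i. V i \<noteq> UNIV}" "\<sigma> \<in> Pi\<^sub>E UNIV V" "Pi\<^sub>E UNIV V \<subseteq> W"
        using \<open>openin ?T W\<close> \<open>\<sigma> \<in> W\<close> by (auto simp: openin_product_topology_alt)
      obtain xs where xs: "set xs = {i. V i \<noteq> UNIV}"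
        using finite_list[OF V(1)] by blast
      have "\<sigma> \<in> K (map (\<lambda>x. (x, \<sigma> x)) xs)" by (auto simp: K_def)
      moreover have "K (map (\<lambda>x. (x, \<sigma> x)) xs) \<subseteq> Pi\<^sub>E UNIV V"
      proof
        fix \<sigma>' assume "\<sigma>' \<in> K (map (\<lambda>x. (x, \<sigma> x)) xs)"
        then have eq: "V x \<noteq> UNIV \<Longrightarrow> \<sigma>' x = \<sigma> x" for x
          using xs by (auto simp: K_def)
        have "\<sigma>' x \<in> V x" for x
          by (cases "V x = UNIV") (use eq[of x] V(2) in \<open>auto simp: PiE_iff\<close>)
        then show "\<sigma>' \<in> Pi\<^sub>E UNIV V" by auto
      qed
      ultimately show ?thesis using V(3) by blast
    qed
    then have "W = (\<Union>l\<in>{l. K l \<subseteq> W}. K l)" by blast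
    also have "\<dots> \<in> sets ?M"
      by (rule sets.countable_UN') (use K in auto)
    finally show ?thesis .
  qed
  moreover have "space ?M = UNIV" by (simp add: space_PiM)
  ultimately show "sets (config_space :: ('a, 'd) config measure) \<subseteq> sets ?M"
    unfolding config_space_def
    using sets.sigma_sets_subset[of "{W. openin ?T W}" ?M] by (auto simp: sets_measure_of)
  have gen: "{{f \<in> UNIV \<rightarrow>\<^sub>E space (count_space UNIV). f i \<in> A} | i A.
          i \<in> UNIV \<and> A \<in> sets (count_space UNIV)}
        \<subseteq> sets (config_space :: ('a, 'd) config measure)"
    using coordinate_sets_config_space by (fastforce simp: vimage_def)
  show "sets ?M \<subseteq> sets (config_space :: ('a, 'd) config measure)"
    using sets.sigma_sets_subset[OF gen] unfolding sets_PiM_single by simp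
qed

lemma sets_local_field_subset: "sets (local_field V) \<subseteq> sets config_space"
proof -
  have "{(\<lambda>\<sigma>. \<sigma> x) -` B | x B. x \<in> V} \<subseteq> sets config_space"
    using coordinate_sets_config_space by blast
  from sets.sigma_sets_subset[OF this] show ?thesis
    by (simp add: local_field_def sets_measure_of)
qed

lemma subalgebra_local_field:
  assumes "sets P = sets config_space"
  shows "subalgebra P (local_field V)"
  using sets_local_field_subset sets_eq_imp_space_eq[OF assms]
  by (auto simp: subalgebra_def assms)

end

theory Submission
  imports Defs
begin

text \<open>On the cylinder of a pattern \<open>A\<close> the first repetition time is the first occurrence time of
  \<open>A\<close>, so the claim is that conditioning on the cylinder hardly changes the law of the first
  occurrence. The boundedness of the single-site Hamiltonians gives a uniform finite-energy
  property with some \<open>\<delta> > 0\<close>; hence \<open>p = P(A)\<close> is exponentially small in \<open>N = (n + 1)\<^sup>d\<close>, and so is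
  the probability that the configuration repeats its initial cube under a given shift. By the
  union bound and Markov's inequality, apart from a set of patterns of total probability
  \<open>O(e\<^bsup>-bN\<^esup>)\<close>, a return within distance \<open>O(N)\<close> has conditional probability at most
  \<open>p\<^bsup>\<rho>\<^esup>\<close>. Occurrences further away decouple from the cylinder by mixing, up to an error
  \<open>O(p\<^bsup>\<rho>\<^esup> (1 + t))\<close>. For large \<open>t\<close> the conditional tail is at most \<open>1 / p\<close> times the
  unconditional one, and the two bounds are interpolated.\<close>

section \<open>Finite energy\<close>

text \<open>The supremum is the real one, so boundedness must be shown: locality lets
  \<open>U A\<close> take only finitely many values, one for each configuration on the finite volume
  \<open>A\<close>.\<close>

lemma interaction_sup_bound:
  fixes U :: "('d::finite) site set \<Rightarrow> ('a::finite, 'd) config \<Rightarrow> real"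
  assumes "interaction U" and A: "A \<in> finite_volumes"
  shows "\<bar>U A \<sigma>\<bar> \<le> (SUP \<sigma>. \<bar>U A \<sigma>\<bar>)"
proof (rule cSUP_upper)
  have "range (\<lambda>\<sigma>. \<bar>U A \<sigma>\<bar>) \<subseteq> (\<lambda>\<sigma>. \<bar>U A \<sigma>\<bar>) ` (A \<rightarrow>\<^sub>E UNIV)"
  proof (rule image_subsetI)
    fix \<sigma> :: "('a, 'd) config"
    have "restrict \<sigma> A = restrict (restrict \<sigma> A) A"
      by (simp add: restrict_def fun_eq_iff)
    with assms have "U A \<sigma> = U A (restrict \<sigma> A)"
      unfolding interaction_def by blast
    then show "\<bar>U A \<sigma>\<bar> \<in> (\<lambda>\<sigma>. \<bar>U A \<sigma>\<bar>) ` (A \<rightarrow>\<^sub>E UNIV)"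
      by (intro image_eqI[of _ _ "restrict \<sigma> A"]) auto
  qed
  moreover have "finite (A \<rightarrow>\<^sub>E (UNIV :: 'a set))"
    using A by (intro finite_PiE) (auto simp: finite_volumes_def)
  ultimately have "finite (range (\<lambda>\<sigma>. \<bar>U A \<sigma>\<bar>))"
    by (meson finite_imageI finite_subset)
  then show "bdd_above (range (\<lambda>\<sigma>. \<bar>U A \<sigma>\<bar>))"
    by (rule bdd_above_finite)
qed simp

text \<open>The volumes containing \<open>x\<close> are the translates of those containing 0, and
  translation invariance moves the shift onto the configuration. The bound is therefore uniform in
  the site and in the boundary condition.\<close>

lemma single_site_hamiltonian_bound:
  fixes U :: "('d::finite) site set \<Rightarrow> ('a::finite, 'd) config \<Rightarrow> real"
  assumes U: "interaction U"
  shows "\<bar>hamiltonian U {x} \<zeta> \<sigma>\<bar> \<le>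
    (\<Sum>\<^sub>\<infinity>A\<in>{A \<in> finite_volumes. 0 \<in> A}. SUP \<sigma>. \<bar>U A \<sigma>\<bar>)"
proof -
  define \<omega> where "\<omega> = glue {x} \<sigma> \<zeta>"
  define X where "X = {A \<in> finite_volumes. A \<inter> {x} \<noteq> {}}"
  define Z :: "'d site set set" where "Z = {A \<in> finite_volumes. 0 \<in> A}"
  have bij: "bij_betw (\<lambda>A. (\<lambda>y. y + x) ` A) Z X"
    by (rule bij_betw_byWitness[where f' = "\<lambda>A. (\<lambda>y. y - x) ` A"])
       (auto simp: Z_def X_def finite_volumes_def image_image image_iff)
  have eq: "U ((\<lambda>y. y + x) ` A) \<omega> = U A (translate x \<omega>)" if "A \<in> Z" for A
  proof -
    have "\<omega> = translate (- x) (translate x \<omega>)" by (simp add: translate_def)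
    then show ?thesis
      using U that unfolding interaction_def Z_def by (metis (no_types, lifting) mem_Collect_eq)
  qed
  have bound: "norm (U A (translate x \<omega>)) \<le> (SUP \<sigma>. \<bar>U A \<sigma>\<bar>)" if "A \<in> Z" for A
    using interaction_sup_bound[OF U] that by (simp add: Z_def)
  have sum: "(\<lambda>A. SUP \<sigma>. \<bar>U A \<sigma>\<bar>) summable_on Z"
    using U by (simp add: interaction_def Z_def)
  have abs: "(\<lambda>A. norm (U A (translate x \<omega>))) summable_on Z"
    using sum bound by (rule Infinite_Sum.abs_summable_on_comparison_test')
  have "hamiltonian U {x} \<zeta> \<sigma> = infsum (\<lambda>A. U A \<omega>) X"
    by (simp add: hamiltonian_def X_def \<omega>_def)
  also have "\<dots> = infsum (\<lambda>A. U ((\<lambda>y. y + x) ` A) \<omega>) Z"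
    using infsum_reindex_bij_betw[OF bij, of "\<lambda>A. U A \<omega>"] by simp
  also have "\<dots> = infsum (\<lambda>A. U A (translate x \<omega>)) Z"
    by (rule infsum_cong) (rule eq)
  finally have "\<bar>hamiltonian U {x} \<zeta> \<sigma>\<bar> \<le> infsum (\<lambda>A. norm (U A (translate x \<omega>))) Z"
    using norm_infsum_bound[OF abs] by simp
  also have "\<dots> \<le> infsum (\<lambda>A. SUP \<sigma>. \<bar>U A \<sigma>\<bar>) Z"
    using abs sum bound by (rule infsum_mono)
  finally show ?thesis by (simp add: Z_def)
qed

lemma single_site_configs: "card (local_configs {x} :: ('a::finite, 'd::finite) config set) = CARD('a)"
  by (simp add: local_configs_def card_PiE)

lemma single_site_configs_finite: "finite (local_configs {x} :: ('a::finite, 'd::finite) config set)"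
  by (simp add: local_configs_def finite_PiE)

text \<open>Given the exterior, the weight of each symbol at \<open>x\<close> lies between
  \<open>exp (- h)\<close> and \<open>exp h\<close>, so its conditional probability is at least
  \<open>exp (- h) / (CARD('a) * exp h)\<close>. Integrating over an exterior event \<open>E\<close>
  removes the conditioning.\<close>

lemma gibbs_finite_energy:
  fixes P :: "('a::finite, 'd::finite) config measure"
  assumes U: "interaction U" and G: "gibbs_field U P"
  shows "\<exists>\<delta>>0. \<forall>x a. \<forall>E\<in>sets (local_field (- {x})). \<delta> * measure P E \<le> measure P (E \<inter> {\<sigma>. \<sigma> x = a})"
proof -
  define h where "h = (\<Sum>\<^sub>\<infinity>A\<in>{A \<in> finite_volumes. (0 :: 'd site) \<in> A}. SUP \<sigma>. \<bar>U A \<sigma>\<bar>)"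
  define \<delta> where "\<delta> = exp (- h) / (real CARD('a) * exp h)"
  have sets: "sets P = sets config_space" using G by (simp add: gibbs_field_def)
  interpret prob_space P using G by (simp add: gibbs_field_def)
  have "\<delta> * measure P E \<le> measure P (E \<inter> {\<sigma>. \<sigma> x = a})"
    if E: "E \<in> sets (local_field (- {x}))" for x a E
  proof -
    define F where "F = {\<sigma> :: ('a, 'd) config. \<sigma> x = a}"
    define \<xi> :: "('a, 'd) config" where "\<xi> = restrict (\<lambda>_. a) {x}"
    have sub: "subalgebra P (local_field (- {x}))"
      using sets by (rule subalgebra_local_field)
    interpret finite_measure_subalgebra P "local_field (- {x})"
      by unfold_locales (rule sub)
    have Fm: "F \<in> sets P"
      using coordinate_sets_config_space[of x "{a}"] by (simp add: F_def sets vimage_def)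
    have Em: "E \<in> sets P" using E sets_local_field_subset[of "- {x}"] sets by auto
    have \<xi>: "\<xi> \<in> local_configs {x}" by (simp add: \<xi>_def local_configs_def)
    \<comment> \<open>The Gibbs condition speaks of points of \<open>local_configs {x}\<close>; the
      symbol \<open>a\<close> corresponds to the extensional function \<xi>.\<close>
    have F: "F = {\<sigma>. restrict \<sigma> {x} = \<xi>}"
      by (auto simp: F_def \<xi>_def fun_eq_iff restrict_def)
    have "{x} \<in> finite_volumes" by (simp add: finite_volumes_def)
    then have "AE \<zeta> in P. \<forall>\<xi>\<in>local_configs {x}.
        real_cond_exp P (local_field (- {x})) (indicator {\<sigma>. restrict \<sigma> {x} = \<xi>}) \<zeta> =
          exp (- hamiltonian U {x} \<zeta> \<xi>) / (\<Sum>\<eta>\<in>local_configs {x}. exp (- hamiltonian U {x} \<zeta> \<eta>))"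
      using G by (simp add: gibbs_field_def)
    then have AE: "AE \<zeta> in P. \<delta> \<le> real_cond_exp P (local_field (- {x})) (indicator F) \<zeta>"
    proof eventually_elim
      case (elim \<zeta>)
      have H: "\<bar>hamiltonian U {x} \<zeta> \<eta>\<bar> \<le> h" for \<eta>
        unfolding h_def by (rule single_site_hamiltonian_bound[OF U])
      have "(\<Sum>\<eta>\<in>local_configs {x}. exp (- hamiltonian U {x} \<zeta> \<eta>)) \<le>
          real (card (local_configs {x} :: ('a, 'd) config set)) * exp h"
        by (rule sum_bounded_above) (use H in \<open>auto simp: abs_le_iff minus_le_iff\<close>)
      moreover have "(\<Sum>\<eta>\<in>local_configs {x}. exp (- hamiltonian U {x} \<zeta> \<eta>)) > 0"
        using single_site_configs_finite \<xi> by (intro sum_pos) auto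
      moreover have "exp (- h) \<le> exp (- hamiltonian U {x} \<zeta> \<xi>)"
        using H[of \<xi>] by simp
      ultimately show ?case
        using elim \<xi> unfolding F \<delta>_def by (auto simp: single_site_configs intro!: frac_le)
    qed
    have int: "integrable P (indicator F :: _ \<Rightarrow> real)"
      using Fm by (simp add: integrable_real_indicator emeasure_eq_measure)
    have "\<delta> * measure P E = (\<integral>\<zeta>\<in>E. \<delta> \<partial>P)"
      using Em by (simp add: set_integral_const emeasure_eq_measure)
    also have "\<dots> \<le> (\<integral>\<zeta>\<in>E. real_cond_exp P (local_field (- {x})) (indicator F) \<zeta> \<partial>P)"
    proof (rule set_integral_mono_AE)
      show "set_integrable P E (\<lambda>\<zeta>. \<delta>)"
        using Em by (simp add: set_integrable_def emeasure_eq_measure)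
      show "set_integrable P E (real_cond_exp P (local_field (- {x})) (indicator F))"
        unfolding set_integrable_def
        using integrable_mult_indicator[OF Em real_cond_exp_int(1)[OF int]] by simp
      show "AE \<zeta> in P. \<zeta> \<in> E \<longrightarrow> \<delta> \<le> real_cond_exp P (local_field (- {x})) (indicator F) \<zeta>"
        using AE by eventually_elim simp
    qed
    also have "\<dots> = (\<integral>\<zeta>\<in>E. indicator F \<zeta> \<partial>P)"
      using real_cond_exp_intA[OF int E] by simp
    also have "\<dots> = measure P (E \<inter> F)"
      using Em Fm by (simp add: set_lebesgue_integral_def indicator_inter_arith[symmetric]
          measure_def Int_commute)
    finally show ?thesis by (simp add: F_def)
  qed
  moreover have "\<delta> > 0" by (simp add: \<delta>_def)
  ultimately show ?thesis by blast
qed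

section \<open>Probabilities of patterns and of periodic configurations\<close>

lemma local_field_mono:
  assumes "V \<subseteq> W"
  shows "sets (local_field V) \<subseteq> sets (local_field W)"
  using assms by (auto simp: local_field_def sets_measure_of intro!: sigma_sets_mono')

lemma coordinate_sets_local_field: "x \<in> V \<Longrightarrow> {\<sigma>. \<sigma> x \<in> B} \<in> sets (local_field V)"
  by (auto simp: local_field_def sets_measure_of vimage_def intro!: sigma_sets.Basic)

lemma coordinate_eq_sets_local_field:
  assumes "x \<in> V" "y \<in> V"
  shows "{\<sigma>. \<sigma> x = \<sigma> y} \<in> sets (local_field V)"
proof -
  have "{\<sigma>. \<sigma> x = \<sigma> y} = (\<Union>a. {\<sigma>. \<sigma> x \<in> {a}} \<inter> {\<sigma>. \<sigma> y \<in> {a}})" by auto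
  also have "\<dots> \<in> sets (local_field V)"
    using assms by (intro sets.finite_UN sets.Int coordinate_sets_local_field) auto
  finally show ?thesis .
qed

lemma ball_sets_local_field:
  assumes "finite V" "\<And>y. y \<in> V \<Longrightarrow> {\<sigma>. Q y \<sigma>} \<in> sets (local_field W)"
  shows "{\<sigma>. \<forall>y\<in>V. Q y \<sigma>} \<in> sets (local_field W)"
  using sets.sets_Collect_finite_All[of V "local_field W" Q] assms by simp

definition agree :: "('d::finite) site set \<Rightarrow> ('a, 'd) config \<Rightarrow> ('a, 'd) config set" where
  "agree V A = {\<sigma>. \<forall>y\<in>V. \<sigma> y = A y}"

lemma agree_sets_local_field:
  fixes A :: "('a::finite, 'd::finite) config"
  assumes "finite V"
  shows "agree V A \<in> sets (local_field V)"
  unfolding agree_def using assms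
  by (rule ball_sets_local_field) (use coordinate_sets_local_field[of _ V "{_}"] in auto)

text \<open>The reference sites \<open>v - x\<close> may lie outside \<open>V\<close>. Each site of
  \<open>V\<close> thus carries one constraint, and \<open>V\<close> can be built up site by
  site.\<close>

definition periodic :: "('d::finite) site \<Rightarrow> 'd site set \<Rightarrow> ('a, 'd) config set" where
  "periodic x V = {\<sigma>. \<forall>v\<in>V. \<sigma> v = \<sigma> (v - x)}"

lemma periodic_sets_local_field:
  assumes "finite V" "V \<subseteq> W" "(\<lambda>v. v - x) ` V \<subseteq> W"
  shows "(periodic x V :: ('a::finite, 'd::finite) config set) \<in> sets (local_field W)"
  unfolding periodic_def using assms
  by (intro ball_sets_local_field coordinate_eq_sets_local_field) auto

text \<open>\<open>energy\<close> is the form in which the Gibbs property enters the estimates. The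
  second symbol keeps the conditional probability of any given symbol away from 1, which makes
  patterns exponentially unlikely.\<close>

locale finite_energy_field = prob_space P
  for P :: "('a::finite, 'd::finite) config measure" +
  fixes \<delta> :: real
  assumes sets_P: "sets P = sets config_space"
    and two_symbols: "CARD('a) \<ge> 2"
    and delta_pos: "\<delta> > 0"
    and energy: "E \<in> sets (local_field (- {x})) \<Longrightarrow> \<delta> * prob E \<le> prob (E \<inter> {\<sigma>. \<sigma> x = a})"
begin

lemma space_P [simp]: "space P = UNIV"
  using sets_eq_imp_space_eq[OF sets_P] by simp

lemma local_field_event: "E \<in> sets (local_field V) \<Longrightarrow> E \<in> events"
  using sets_local_field_subset[of V] sets_P by auto

lemma coordinate_event: "{\<sigma>. \<sigma> x = a} \<in> events"
  using local_field_event[OF coordinate_sets_local_field[of x UNIV "{a}"]] by simp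

text \<open>A different symbol \<open>b\<close> claims at least the share \<delta> of
  \<open>E\<close>, so at most the share 1 - \<delta> is left for \<open>a\<close>.\<close>

lemma energy_two:
  assumes E: "E \<in> sets (local_field (- {x}))"
  shows "prob (E \<inter> {\<sigma>. \<sigma> x = a}) + \<delta> * prob E \<le> prob E"
proof -
  have "card (UNIV - {a}) \<noteq> 0" using two_symbols by (subst card_Diff_singleton) auto
  then obtain b where "b \<noteq> a" by (metis Diff_iff card_eq_0_iff ex_in_conv insert_iff)
  have "prob (E \<inter> {\<sigma>. \<sigma> x = a}) + prob (E \<inter> {\<sigma>. \<sigma> x = b}) =
      prob (E \<inter> {\<sigma>. \<sigma> x = a} \<union> E \<inter> {\<sigma>. \<sigma> x = b})"
    using local_field_event[OF E] coordinate_event \<open>b \<noteq> a\<close>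
    by (intro finite_measure_Union[symmetric]) auto
  also have "\<dots> \<le> prob E"
    using local_field_event[OF E] by (intro finite_measure_mono) auto
  finally show ?thesis using energy[OF E, of b] by simp
qed

lemma delta_half: "\<delta> \<le> 1 / 2"
proof -
  have "UNIV \<in> sets (local_field (- {0}))"
    using sets.top[of "local_field (- {0})"] by simp
  from energy[OF this, of undefined] energy_two[OF this, of undefined]
  show ?thesis using prob_space by simp
qed

text \<open>The sites are revealed one by one. The event on the sites already revealed is exterior
  to the next site, so each new site contributes a factor between \<delta> and 1 - \<delta>.\<close>

lemma agree_bounds:
  assumes "finite V"
  shows "\<delta> ^ card V \<le> prob (agree V A) \<and> prob (agree V A) \<le> (1 - \<delta>) ^ card V"
  using assms
proof (induction V)
  case empty
  then show ?case using prob_space by (simp add: agree_def)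
next
  case (insert v V)
  have "agree V A \<in> sets (local_field (- {v}))"
    using agree_sets_local_field[OF insert(1)] local_field_mono[of V "- {v}"] insert(2) by blast
  from energy[OF this, of "A v"] energy_two[OF this, of "A v"]
  have "\<delta> * prob (agree V A) \<le> prob (agree (insert v V) A)"
    "prob (agree (insert v V) A) \<le> (1 - \<delta>) * prob (agree V A)"
    by (auto simp: agree_def Int_def algebra_simps conj_commute)
  moreover have "\<delta> * \<delta> ^ card V \<le> \<delta> * prob (agree V A)"
    using insert.IH delta_pos by (intro mult_left_mono) auto
  moreover have "(1 - \<delta>) * prob (agree V A) \<le> (1 - \<delta>) * (1 - \<delta>) ^ card V"
    using insert.IH delta_half by (intro mult_left_mono) auto
  ultimately show ?case using insert(1,2) by simp
qed

text \<open>Revealing the sites in increasing order of their coordinate sum, each one is forced to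
  repeat the symbol at an earlier site.\<close>

lemma periodic_bound:
  fixes x :: "'d site"
  assumes "finite V" and x: "0 < (\<Sum>i\<in>UNIV. x $ i)"
  shows "prob (periodic x V) \<le> (1 - \<delta>) ^ card V"
  using assms(1)
proof (induction V rule: finite_ranking_induct[where f = "\<lambda>v. \<Sum>i\<in>UNIV. v $ i"])
  case empty
  then show ?case using prob_space by (simp add: periodic_def)
next
  case (insert v V)
  show ?case
  proof (cases "v \<in> V")
    case True
    then show ?thesis using insert by (simp add: insert_absorb)
  next
    case False
    have less: "(\<Sum>i\<in>UNIV. (u - x) $ i) < (\<Sum>i\<in>UNIV. u $ i)" for u
      using x by (simp add: sum_subtractf)
    \<comment> \<open>The new site \<open>v\<close> has the largest coordinate sum so far, and
      \<open>u - x\<close> has a smaller sum than \<open>u\<close>. Hence \<open>v\<close> is never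
      a reference site, and the earlier constraints stay exterior to \<open>v\<close>.\<close>
    have notin: "v \<noteq> u - x" if "u \<in> insert v V" for u
      using insert(2)[of u] less[of u] that by force
    have "x \<noteq> 0" using x by auto
    \<comment> \<open>Splitting by the symbol at \<open>v - x\<close> replaces the random
      requirement on \<open>\<sigma> v\<close> by a fixed symbol, to which \<open>energy_two\<close>
      applies.\<close>
    define E where "E a = periodic x V \<inter> {\<sigma>. \<sigma> (v - x) \<in> {a}}" for a :: 'a
    have E: "E a \<in> sets (local_field (- {v}))" for a
      unfolding E_def using insert(1) False notin \<open>x \<noteq> 0\<close>
      by (intro sets.Int periodic_sets_local_field coordinate_sets_local_field) auto
    note Eev = local_field_event[OF E]
    have "prob (periodic x (insert v V)) = prob (\<Union>a. E a \<inter> {\<sigma>. \<sigma> v = a})"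
      by (rule arg_cong[where f = prob]) (auto simp: periodic_def E_def)
    also have "\<dots> = (\<Sum>a\<in>UNIV. prob (E a \<inter> {\<sigma>. \<sigma> v = a}))"
      using Eev coordinate_event
      by (intro finite_measure_finite_Union) (auto simp: disjoint_family_on_def E_def)
    also have "\<dots> \<le> (\<Sum>a\<in>UNIV. (1 - \<delta>) * prob (E a))"
      using energy_two[OF E] by (intro sum_mono) (simp add: algebra_simps)
    also have "\<dots> = (1 - \<delta>) * (\<Sum>a\<in>UNIV. prob (E a))"
      by (simp add: sum_distrib_left)
    also have "(\<Sum>a\<in>UNIV. prob (E a)) = prob (\<Union>a. E a)"
      using Eev
      by (intro finite_measure_finite_Union[symmetric]) (auto simp: disjoint_family_on_def E_def)
    also have "(\<Union>a. E a) = periodic x V" by (auto simp: E_def)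
    also have "(1 - \<delta>) * prob (periodic x V) \<le> (1 - \<delta>) * (1 - \<delta>) ^ card V"
      using insert(3) delta_half by (intro mult_left_mono) auto
    finally show ?thesis using insert(1) False by simp
  qed
qed

end

section \<open>Occurrences and decoupling\<close>

lemma cube_eq_image: "(cube n :: ('d::finite) site set) = vec_lambda ` (UNIV \<rightarrow>\<^sub>E {0..int n})"
proof
  show "cube n \<subseteq> vec_lambda ` ((UNIV :: 'd set) \<rightarrow>\<^sub>E {0..int n})"
  proof
    fix x :: "'d site" assume "x \<in> cube n"
    then show "x \<in> vec_lambda ` (UNIV \<rightarrow>\<^sub>E {0..int n})"
      by (intro image_eqI[of _ _ "vec_nth x"]) (auto simp: cube_def)
  qed
qed (auto simp: cube_def PiE_iff)

lemma finite_cube [simp]: "finite (cube n)"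
  unfolding cube_eq_image by (intro finite_imageI finite_PiE) auto

lemma card_cube: "card (cube n :: ('d::finite) site set) = (n + 1) ^ CARD('d)"
  unfolding cube_eq_image
  by (subst card_image) (auto simp: inj_on_def vec_lambda_inject card_PiE nat_add_distrib)

lemma cube_mono: "m \<le> n \<Longrightarrow> cube m \<subseteq> cube n"
  unfolding cube_def by (auto intro: order_trans[of _ "int m" "int n"])

lemma zero_in_cube [simp]: "0 \<in> cube n"
  by (simp add: cube_def)

lemma cube_nonempty: "cube n \<noteq> {}"
  using zero_in_cube by blast

lemma finite_patterns [simp]: "finite (patterns n :: ('a::finite, 'd::finite) config set)"
  unfolding patterns_def local_configs_def by (intro finite_PiE) auto

definition occurs :: "nat \<Rightarrow> ('a, 'd::finite) config \<Rightarrow> 'd site \<Rightarrow> ('a, 'd) config set" where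
  "occurs n A x = {\<sigma>. \<forall>y\<in>cube n. \<sigma> (x + y) = A y}"

definition avoids :: "nat \<Rightarrow> ('a, 'd::finite) config \<Rightarrow> 'd site set \<Rightarrow> ('a, 'd) config set" where
  "avoids n A S = {\<sigma>. \<forall>x\<in>S. \<sigma> \<notin> occurs n A x}"

lemma occurs_iff_restrict:
  assumes "A \<in> patterns n"
  shows "\<sigma> \<in> occurs n A x \<longleftrightarrow> restrict (translate x \<sigma>) (cube n) = A"
proof -
  have "\<And>y. y \<notin> cube n \<Longrightarrow> A y = undefined"
    using assms by (auto simp: patterns_def local_configs_def PiE_def extensional_def)
  then show ?thesis
    by (auto simp: occurs_def translate_def fun_eq_iff restrict_def)
qed

lemma cylinder_eq_occurs: "A \<in> patterns n \<Longrightarrow> cylinder n A = occurs n A 0"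
  using occurs_iff_restrict[of A n _ 0] by (auto simp: cylinder_def translate_def)

lemma occurs_zero_eq_agree: "occurs n A 0 = agree (cube n) A"
  by (simp add: occurs_def agree_def)

lemma occurs_eq_agree: "occurs n A x = agree ((+) x ` cube n) (\<lambda>y. A (y - x))"
  by (simp add: occurs_def agree_def)

lemma occurs_sets_local_field:
  fixes A :: "('a::finite, 'd::finite) config"
  assumes "(+) x ` cube n \<subseteq> W"
  shows "occurs n A x \<in> sets (local_field W)"
  using agree_sets_local_field[of "(+) x ` cube n"] local_field_mono[OF assms]
  unfolding occurs_eq_agree by auto

lemma avoids_sets_local_field:
  fixes A :: "('a::finite, 'd::finite) config"
  assumes "finite S" "(\<Union>x\<in>S. (+) x ` cube n) \<subseteq> W"
  shows "avoids n A S \<in> sets (local_field W)"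
  unfolding avoids_def
proof (rule ball_sets_local_field[OF assms(1)])
  fix x assume "x \<in> S"
  then have "occurs n A x \<in> sets (local_field W)"
    using assms(2) by (intro occurs_sets_local_field) auto
  from sets.compl_sets[OF this] show "{\<sigma>. \<sigma> \<notin> occurs n A x} \<in> sets (local_field W)"
    by (simp add: Compl_eq Compl_eq_Diff_UNIV[symmetric])
qed

lemma site_norm_pos_iff: "site_norm x > 0 \<longleftrightarrow> x \<noteq> 0"
proof -
  have "site_norm x \<ge> 0" by (simp add: site_norm_def sum_nonneg)
  moreover have "site_norm x = 0 \<longleftrightarrow> x = 0"
    by (simp add: site_norm_def sum_nonneg_eq_0_iff vec_eq_iff)
  ultimately show ?thesis by auto
qed

text \<open>Cubes are nested, so the set \<open>J\<close> of admissible radii is upward closed. Its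
  minimum therefore exceeds the real number \<open>k\<close> exactly when the integer part of
  \<open>k\<close> is not in \<open>J\<close>. This turns a tail of the hitting time into a local
  event.\<close>

lemma first_occurrence_gt_iff:
  fixes A :: "('a::finite, 'd::finite) config"
  assumes A: "A \<in> patterns n" and k: "k \<ge> 0"
  shows "ereal_of_enat (first_occurrence n A \<sigma>) > ereal k \<longleftrightarrow>
    \<sigma> \<in> avoids n A (cube (nat \<lfloor>k\<rfloor>) - {0})"
proof -
  define J where "J = {j. \<exists>x\<in>cube j - {0}. \<sigma> \<in> occurs n A x}"
  have t: "first_occurrence n A \<sigma> = Inf (enat ` J)"
    unfolding first_occurrence_def J_def
    by (rule arg_cong[where f = Inf])
       (auto simp: cube_def site_norm_pos_iff occurs_iff_restrict[OF A] image_iff)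
  have "ereal_of_enat (first_occurrence n A \<sigma>) > ereal k \<longleftrightarrow> (\<forall>j\<in>J. real j > k)"
  \<comment> \<open>An empty \<open>J\<close> is the case of no occurrence at all: the infimum is
    \<infinity> and exceeds every real \<open>k\<close>.\<close>
  proof (cases "J = {}")
    case True
    then show ?thesis by (simp add: t top_enat_def)
  next
    case False
    then have "Inf (enat ` J) = enat (LEAST j. j \<in> J)"
      by (intro antisym Inf_lower Inf_greatest) (auto intro: LeastI Least_le)
    with False show ?thesis
      by (auto simp: t intro: LeastI dest: Least_le[of "\<lambda>j. j \<in> J"])
  qed
  also have "\<dots> \<longleftrightarrow> nat \<lfloor>k\<rfloor> \<notin> J"
  proof
    assume "nat \<lfloor>k\<rfloor> \<notin> J"
    moreover have "nat \<lfloor>k\<rfloor> \<in> J" if "j \<in> J" "real j \<le> k" for j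
    proof -
      have "j \<le> nat \<lfloor>k\<rfloor>" using that(2) by (simp add: le_nat_floor)
      then have "cube j \<subseteq> (cube (nat \<lfloor>k\<rfloor>) :: 'd site set)"
        by (rule cube_mono)
      then show ?thesis using that(1) by (auto simp: J_def)
    qed
    ultimately show "\<forall>j\<in>J. real j > k" by (meson not_le_imp_less)
  next
    assume "\<forall>j\<in>J. real j > k"
    moreover have "real (nat \<lfloor>k\<rfloor>) \<le> k" using k by simp
    ultimately show "nat \<lfloor>k\<rfloor> \<notin> J" by force
  qed
  also have "\<dots> \<longleftrightarrow> \<sigma> \<in> avoids n A (cube (nat \<lfloor>k\<rfloor>) - {0})"
    by (auto simp: J_def avoids_def)
  finally show ?thesis .
qed

lemma first_repetition_eq_first_occurrence:
  "\<sigma> \<in> cylinder n A \<Longrightarrow> first_repetition n \<sigma> = first_occurrence n A \<sigma>"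
  by (simp add: first_repetition_def first_occurrence_def cylinder_def)

text \<open>Once the Borel sigma-field is read as the product sigma-field, measurability is checked
  on coordinates, which a translation merely permutes.\<close>

lemma translate_measurable:
  fixes P :: "('a::finite, 'd::finite) config measure"
  assumes "sets P = sets config_space"
  shows "translate x \<in> measurable P P"
proof -
  have eq: "sets P = sets (\<Pi>\<^sub>M x\<in>(UNIV :: 'd site set). count_space (UNIV :: 'a set))"
    using assms sets_config_space by simp
  have "translate x \<in> measurable (\<Pi>\<^sub>M x\<in>(UNIV :: 'd site set). count_space (UNIV :: 'a set))
      (\<Pi>\<^sub>M x\<in>(UNIV :: 'd site set). count_space (UNIV :: 'a set))"
    unfolding translate_def
    by (rule measurable_PiM_single') (auto simp: space_PiM)
  then show ?thesis using measurable_cong_sets[OF eq eq] by simp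
qed

text \<open>The l1 norm dominates every coordinate, so separation in one coordinate, possibly
  depending on the pair of sites, suffices.\<close>

lemma volume_dist_ge:
  assumes "A \<in> finite_volumes" "B \<in> finite_volumes"
    and "\<And>x y. x \<in> A \<Longrightarrow> y \<in> B \<Longrightarrow> \<exists>i. m \<le> x $ i - y $ i"
  shows "m \<le> volume_dist A B"
proof -
  have "m \<le> site_norm (x - y)" if "x \<in> A" "y \<in> B" for x y
  proof -
    obtain i where "m \<le> x $ i - y $ i" using assms(3) \<open>x \<in> A\<close> \<open>y \<in> B\<close> by blast
    also have "\<dots> \<le> \<bar>(x - y) $ i\<bar>" by simp
    also have "\<dots> \<le> site_norm (x - y)"
      unfolding site_norm_def by (rule member_le_sum) auto
    finally show ?thesis .
  qed
  then show ?thesis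
    using assms(1,2) unfolding volume_dist_def finite_volumes_def
    by (intro Min.boundedI) auto
qed

text \<open>\<open>mixing\<close> is the bound on the coefficient, freed from its supremum and
  multiplied by the volume of \<open>A\<^sub>1\<close>. The volume factor is charged to the event
  \<open>E\<^sub>1\<close> only; the conditioning event \<open>E\<^sub>2\<close> contributes
  none.\<close>

locale mixing_field = finite_energy_field P \<delta>
  for P :: "('a::finite, 'd::finite) config measure" and \<delta> +
  fixes C\<^sub>1 C\<^sub>2 :: real
  assumes invariant: "translation_invariant P"
    and C1_pos: "C\<^sub>1 > 0" and C2_pos: "C\<^sub>2 > 0"
    and mixing: "\<lbrakk>A\<^sub>1 \<in> finite_volumes; A\<^sub>2 \<in> finite_volumes; m > 0;
        m \<le> real_of_int (volume_dist A\<^sub>1 A\<^sub>2);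
        E\<^sub>1 \<in> sets (local_field A\<^sub>1); E\<^sub>2 \<in> sets (local_field A\<^sub>2); prob E\<^sub>2 > 0\<rbrakk> \<Longrightarrow>
      \<bar>prob (E\<^sub>1 \<inter> E\<^sub>2) / prob E\<^sub>2 - prob E\<^sub>1\<bar> \<le> real (card A\<^sub>1) * (C\<^sub>1 * exp (- C\<^sub>2 * m))"
begin

lemma occurs_event: "occurs n A x \<in> events"
  by (rule local_field_event[OF occurs_sets_local_field[OF order_refl]])

lemma avoids_event: "finite S \<Longrightarrow> avoids n A S \<in> events"
  by (rule local_field_event[OF avoids_sets_local_field[OF _ order_refl]])

lemma prob_occurs: "prob (occurs n A x) = prob (occurs n A 0)"
proof -
  have "prob (occurs n A 0) = measure (distr P P (translate x)) (occurs n A 0)"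
    using invariant by (simp add: translation_invariant_def)
  also have "\<dots> = prob (translate x -` occurs n A 0 \<inter> space P)"
    by (intro measure_distr translate_measurable sets_P occurs_event)
  also have "translate x -` occurs n A 0 \<inter> space P = occurs n A x"
    by (auto simp: occurs_def translate_def)
  finally show ?thesis by simp
qed

lemma cylinder_bounds:
  "\<delta> ^ (n + 1) ^ CARD('d) \<le> prob (occurs n A 0)"
  "prob (occurs n A 0) \<le> (1 - \<delta>) ^ (n + 1) ^ CARD('d)"
  using agree_bounds[OF finite_cube, of n A] by (simp_all add: occurs_zero_eq_agree card_cube)

lemma cylinder_pos: "0 < prob (occurs n A 0)"
  using cylinder_bounds(1) delta_pos by (meson less_le_trans zero_less_power)

text \<open>The event of avoiding \<open>S\<close> lives on the cubes attached to \<open>S\<close>,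
  all inside \<open>cube (K + n)\<close>. Some coordinate of each site in \<open>S\<close> exceeds
  \<open>n + g\<close>, so these cubes are more than \<open>g\<close> away from the conditioning
  cube, and mixing applies.\<close>

lemma avoids_decorrelation:
  assumes S: "S \<subseteq> cube K" and far: "\<And>x. x \<in> S \<Longrightarrow> \<exists>i. x $ i > int n + int g"
  shows "\<bar>prob (avoids n A S \<inter> occurs n A 0) / prob (occurs n A 0) - prob (avoids n A S)\<bar> \<le>
    real ((K + n + 1) ^ CARD('d)) * (C\<^sub>1 * exp (- C\<^sub>2 * real g))"
\<comment> \<open>An empty \<open>S\<close> is treated apart because mixing is stated for nonempty
  volumes.\<close>
proof (cases "S = {}")
  case True
  then have "avoids n A S = UNIV" by (simp add: avoids_def)
  then show ?thesis using cylinder_pos C1_pos prob_space by (simp add: less_imp_neq[symmetric])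
next
  case False
  define V where "V = (\<Union>x\<in>S. (+) x ` cube n)"
  have "finite S" using S finite_subset finite_cube by blast
  have V_cube: "V \<subseteq> cube (K + n)"
    using S unfolding V_def cube_def by (force intro: add_mono)
  have V: "V \<in> finite_volumes"
    using False \<open>finite S\<close> cube_nonempty by (auto simp: V_def finite_volumes_def)
  have cube: "cube n \<in> finite_volumes"
    by (simp add: finite_volumes_def cube_nonempty)
  \<comment> \<open>The extra 1 keeps the distance parameter positive, as \<open>mixing\<close>
    demands, even when \<open>g = 0\<close>.\<close>
  have "int g + 1 \<le> volume_dist V (cube n)"
  proof (rule volume_dist_ge[OF V cube])
    fix z y :: "'d site" assume "z \<in> V" and y: "y \<in> cube n"
    then obtain x u where "x \<in> S" and z: "z = x + u" and u: "u \<in> cube n" by (auto simp: V_def)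
    then obtain i where "x $ i > int n + int g" using far by blast
    moreover have "u $ i \<ge> 0" "y $ i \<le> int n" using u y by (auto simp: cube_def)
    ultimately have "int g + 1 \<le> z $ i - y $ i" by (simp add: z)
    then show "\<exists>i. int g + 1 \<le> z $ i - y $ i" ..
  qed
  then have "\<bar>prob (avoids n A S \<inter> occurs n A 0) / prob (occurs n A 0) - prob (avoids n A S)\<bar> \<le>
      real (card V) * (C\<^sub>1 * exp (- C\<^sub>2 * (real g + 1)))"
    using \<open>finite S\<close> cylinder_pos
    by (intro mixing[OF V cube] avoids_sets_local_field occurs_sets_local_field)
       (auto simp: V_def)
  also have "\<dots> \<le> real ((K + n + 1) ^ CARD('d)) * (C\<^sub>1 * exp (- C\<^sub>2 * real g))"
  proof (rule mult_mono)
    show "real (card V) \<le> real ((K + n + 1) ^ CARD('d))"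
      using card_mono[OF finite_cube V_cube] unfolding card_cube by linarith
    show "C\<^sub>1 * exp (- C\<^sub>2 * (real g + 1)) \<le> C\<^sub>1 * exp (- C\<^sub>2 * real g)"
      using C1_pos C2_pos by simp
  qed (use C1_pos in auto)
  finally show ?thesis .
qed

text \<open>Divided by the probability of the cylinder, this is the union bound for the conditional
  probability of a return within \<open>cube m\<close>.\<close>

definition return_weight :: "nat \<Rightarrow> nat \<Rightarrow> ('a, 'd) config \<Rightarrow> real" where
  "return_weight n m A = (\<Sum>x\<in>cube m - {0}. prob (occurs n A x \<inter> occurs n A 0))"

text \<open>Avoidance is first required only outside \<open>cube (n + g)\<close>. Dropping the near
  sites costs the return weight under the conditional law and a plain union bound under
  \<open>P\<close>; the far sites are handled by mixing.\<close>

lemma conditional_avoidance: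
  "\<bar>prob (avoids n A (cube K - {0}) \<inter> occurs n A 0) / prob (occurs n A 0) -
      prob (avoids n A (cube K - {0}))\<bar> \<le>
    return_weight n (n + g) A / prob (occurs n A 0) +
    real ((n + g + 1) ^ CARD('d)) * prob (occurs n A 0) +
    real ((K + n + 1) ^ CARD('d)) * (C\<^sub>1 * exp (- C\<^sub>2 * real g))"
proof -
  define H where "H = occurs n A 0"
  define E where "E = avoids n A (cube K - {0})"
  define E' where "E' = avoids n A (cube K - cube (n + g))"
  define F where "F = (\<Union>x\<in>cube (n + g) - {0}. occurs n A x)"
  have ev: "H \<in> events" "E \<in> events" "E' \<in> events" "F \<in> events"
    by (auto simp: H_def E_def E'_def F_def occurs_event avoids_event intro!: sets.finite_UN)
  have p: "prob H > 0" using cylinder_pos by (simp add: H_def)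
  \<comment> \<open>The origin belongs to the deleted cube, so \<open>E'\<close> imposes no
    condition there either.\<close>
  have EE': "E \<subseteq> E'" using zero_in_cube by (auto simp: E_def E'_def avoids_def)
  have E'E: "E' \<subseteq> E \<union> F" by (auto simp: E_def E'_def F_def avoids_def)
  have F: "prob F \<le> real ((n + g + 1) ^ CARD('d)) * prob H"
  proof -
    have "prob F \<le> (\<Sum>x\<in>cube (n + g) - {0}. prob (occurs n A x))"
      unfolding F_def using occurs_event by (intro finite_measure_subadditive_finite) auto
    also have "\<dots> = real (card (cube (n + g) - {0 :: 'd site})) * prob H"
      using prob_occurs[of n A, folded H_def] by simp
    also have "\<dots> \<le> real (card (cube (n + g) :: 'd site set)) * prob H"
      by (intro mult_right_mono of_nat_mono card_mono) auto
    finally show ?thesis by (simp add: card_cube)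
  qed
  have FH: "prob (F \<inter> H) \<le> return_weight n (n + g) A"
  proof -
    have "prob (F \<inter> H) = prob (\<Union>x\<in>cube (n + g) - {0}. occurs n A x \<inter> H)"
      by (rule arg_cong[where f = prob]) (auto simp: F_def)
    also have "\<dots> \<le> (\<Sum>x\<in>cube (n + g) - {0}. prob (occurs n A x \<inter> H))"
      using occurs_event ev by (intro finite_measure_subadditive_finite) auto
    finally show ?thesis by (simp add: return_weight_def H_def)
  qed
  have "prob E \<le> prob E'" using EE' ev by (intro finite_measure_mono) auto
  moreover have "prob E' \<le> prob E + prob F"
    using finite_measure_mono[OF E'E] measure_Un_le[of E P F] ev by fastforce
  moreover have "prob (E \<inter> H) / prob H \<le> prob (E' \<inter> H) / prob H"
    using EE' ev p by (intro divide_right_mono finite_measure_mono) auto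
  moreover have "prob (E' \<inter> H) / prob H \<le> prob (E \<inter> H) / prob H + return_weight n (n + g) A / prob H"
  proof -
    have "prob (E' \<inter> H) \<le> prob ((E \<inter> H) \<union> (F \<inter> H))"
      using E'E ev by (intro finite_measure_mono) auto
    also have "\<dots> \<le> prob (E \<inter> H) + prob (F \<inter> H)"
      using ev by (intro measure_Un_le) auto
    also have "\<dots> \<le> prob (E \<inter> H) + return_weight n (n + g) A" using FH by simp
    finally show ?thesis using p by (simp add: add_divide_distrib[symmetric] divide_right_mono)
  qed
  moreover have "\<bar>prob (E' \<inter> H) / prob H - prob E'\<bar> \<le>
      real ((K + n + 1) ^ CARD('d)) * (C\<^sub>1 * exp (- C\<^sub>2 * real g))"
    unfolding E'_def H_def
    by (rule avoids_decorrelation) (force simp: cube_def not_le)+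
  moreover have "return_weight n (n + g) A / prob H \<ge> 0"
    using p by (simp add: return_weight_def sum_nonneg)
  ultimately show ?thesis using F measure_nonneg[of P F]
    unfolding E_def[symmetric] H_def[symmetric] by linarith
qed

text \<open>For a fixed shift \<open>x\<close> the double occurrences of different patterns are
  disjoint. Together they force the configuration to repeat its initial cube under \<open>x\<close>,
  which \<open>periodic_bound\<close> controls.\<close>

lemma sum_return_weight:
  "(\<Sum>A\<in>patterns n. return_weight n m A) \<le>
    real ((m + 1) ^ CARD('d)) * (1 - \<delta>) ^ (n + 1) ^ CARD('d)"
proof -
  have "(\<Sum>A\<in>patterns n. prob (occurs n A x \<inter> occurs n A 0)) \<le> (1 - \<delta>) ^ (n + 1) ^ CARD('d)"
    if x: "x \<in> cube m - {0}" for x :: "'d site"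
  proof -
    \<comment> \<open>Shifts in a cube have nonnegative coordinates, so a nonzero one has the
      positive coordinate sum that \<open>periodic_bound\<close> requires.\<close>
    have "(\<Sum>i\<in>UNIV. x $ i) = site_norm x"
      using x by (auto simp: site_norm_def cube_def)
    then have pos: "0 < (\<Sum>i\<in>UNIV. x $ i)" using x site_norm_pos_iff[of x] by simp
    have "disjoint_family_on (\<lambda>A :: ('a, 'd) config. occurs n A x \<inter> occurs n A 0) (patterns n)"
      unfolding disjoint_family_on_def
    proof (intro ballI impI)
      fix A B :: "('a, 'd) config" assume "A \<in> patterns n" "B \<in> patterns n" "A \<noteq> B"
      then have "occurs n A 0 \<inter> occurs n B 0 = {}"
        by (auto simp: occurs_iff_restrict)
      then show "occurs n A x \<inter> occurs n A 0 \<inter> (occurs n B x \<inter> occurs n B 0) = {}" by blast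
    qed
    then have "(\<Sum>A\<in>patterns n. prob (occurs n A x \<inter> occurs n A 0)) =
        prob (\<Union>A\<in>patterns n. occurs n A x \<inter> occurs n A 0)"
      using occurs_event by (intro finite_measure_finite_Union[symmetric]) auto
    also have "\<dots> \<le> prob (periodic x ((+) x ` cube n))"
    proof (rule finite_measure_mono)
      show "periodic x ((+) x ` cube n) \<in> events"
        by (rule local_field_event[OF periodic_sets_local_field[where W = UNIV]]) auto
    qed (auto simp: occurs_def periodic_def)
    also have "\<dots> \<le> (1 - \<delta>) ^ card ((+) x ` cube n)"
      using pos by (intro periodic_bound) auto
    also have "card ((+) x ` cube n) = (n + 1) ^ CARD('d)"
      by (simp add: card_image card_cube)
    finally show ?thesis .
  qed
  then have "(\<Sum>x\<in>cube m - {0 :: 'd site}. \<Sum>A\<in>patterns n. prob (occurs n A x \<inter> occurs n A 0)) \<le>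
      real (card (cube m - {0 :: 'd site})) * (1 - \<delta>) ^ (n + 1) ^ CARD('d)"
    by (rule sum_bounded_above)
  also have "\<dots> \<le> real (card (cube m :: 'd site set)) * (1 - \<delta>) ^ (n + 1) ^ CARD('d)"
    using delta_half by (intro mult_right_mono of_nat_mono card_mono) auto
  finally show ?thesis
    unfolding return_weight_def card_cube by (subst sum.swap)
qed

end

section \<open>Good patterns\<close>

text \<open>With \<open>s = - ln \<beta>\<close>, the inequality \<open>u \<le> exp u\<close> at
  \<open>u = N * s / d\<close> bounds \<open>N ^ d\<close> by
  \<open>(d / s) ^ d * exp (N * s)\<close>, and the exponential cancels against
  \<open>\<beta> ^ N\<close>.\<close>

lemma power_times_geometric_bounded:
  fixes \<beta> a :: real
  assumes \<beta>: "0 < \<beta>" "\<beta> < 1" and a: "a > 0" and d: "d > 0"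
  shows "\<exists>K>0. \<forall>N::nat. (a * real N) ^ d * \<beta> ^ N \<le> K"
proof (intro exI conjI allI)
  define s where "s = - ln \<beta>"
  have s: "s > 0" using \<beta> by (simp add: s_def)
  show "(a * (real d / s)) ^ d > 0" using a d s by simp
  fix N :: nat
  have "a * real N = (a * (real d / s)) * (real N * s / real d)"
    using d s by (simp add: field_simps)
  also have "\<dots> \<le> (a * (real d / s)) * exp (real N * s / real d)"
  proof (rule mult_left_mono)
    show "real N * s / real d \<le> exp (real N * s / real d)"
      using exp_ge_add_one_self[of "real N * s / real d"] by linarith
  qed (use a d s in auto)
  finally have "(a * real N) ^ d \<le> ((a * (real d / s)) * exp (real N * s / real d)) ^ d"
    using a by (intro power_mono) auto
  also have "\<dots> = (a * (real d / s)) ^ d * exp (real N * s)"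
    using d by (simp only: power_mult_distrib exp_of_nat_mult[symmetric]) simp
  finally have "(a * real N) ^ d * \<beta> ^ N \<le> (a * (real d / s)) ^ d * exp (real N * s) * \<beta> ^ N"
    using \<beta> by (intro mult_right_mono) auto
  also have "\<dots> = (a * (real d / s)) ^ d * (exp (real N * s) * exp (real N * ln \<beta>))"
    using \<beta> by (simp add: exp_of_nat_mult)
  also have "exp (real N * s) * exp (real N * ln \<beta>) = 1"
    by (simp add: s_def exp_add[symmetric])
  finally show "(a * real N) ^ d * \<beta> ^ N \<le> (a * (real d / s)) ^ d" by simp
qed

text \<open>A polynomial bound, small in \<open>p\<close>, and an exponential bound, large in \<open>1 / p\<close>, are
  combined through \<open>D = D\<^bsup>1-\<theta>\<^esup> D\<^bsup>\<theta>\<^esup>\<close>, with \<open>\<theta>\<close> so small that a positive power of \<open>p\<close>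
  survives.\<close>

lemma geometric_interpolation:
  fixes p \<rho> c t Q R D \<theta> :: real
  assumes p: "0 < p" "p \<le> 1" and \<rho>: "\<rho> > 0" and c: "c > 0" and t: "t > 0"
    and Q: "Q \<ge> 1" and R: "R \<ge> 1"
    and D1: "D \<le> Q * p powr \<rho> * (1 + t)" and D2: "D \<le> R * exp (- c * t) / p"
    and \<theta>: "\<theta> = \<rho> / (2 * (1 + \<rho>))"
  shows "D \<le> Q * R * (1 + 2 / (c * \<theta>)) * p powr (\<rho> / 2) * exp (- (c * \<theta> / 2) * t)"
\<comment> \<open>The factorisation of \<open>D\<close> into real powers needs \<open>D > 0\<close>;
  otherwise the nonnegative right-hand side suffices.\<close>
proof (cases "D > 0")
  case False
  have "0 \<le> Q * R * (1 + 2 / (c * \<theta>)) * p powr (\<rho> / 2) * exp (- (c * \<theta> / 2) * t)"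
    using Q R c \<rho> \<theta> by (intro mult_nonneg_nonneg add_nonneg_nonneg divide_nonneg_nonneg) auto
  then show ?thesis using False by linarith
next
  case True
  have \<theta>0: "\<theta> > 0" using \<rho> by (simp add: \<theta>)
  have \<theta>1: "\<theta> < 1" using \<rho> by (simp add: \<theta> field_simps)
  \<comment> \<open>This is the exponent of \<open>p\<close> left after the factor
    \<open>1 / p\<close> has cost \<theta>; the choice of \<theta> makes it half of \<rho>.\<close>
  have split: "\<rho> * (1 - \<theta>) - \<theta> = \<rho> / 2"
  proof -
    have "\<theta> * (1 + \<rho>) = \<rho> / 2" using \<rho> by (simp add: \<theta> field_simps)
    then show ?thesis by (simp add: algebra_simps)
  qed
  \<comment> \<open>The interpolated decay rate is \<open>c * \<theta> = 2 * s\<close>. One half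
    absorbs the linear factor \<open>1 + t\<close>, the other half survives.\<close>
  define s where "s = c * \<theta> / 2"
  have s: "s > 0" using c \<theta>0 by (simp add: s_def)
  have lin: "1 + t \<le> (1 + 1 / s) * exp (s * t)"
  proof -
    have "1 + t \<le> (1 + 1 / s) * (1 + s * t)"
      using s t by (simp add: field_simps)
    also have "\<dots> \<le> (1 + 1 / s) * exp (s * t)"
      using s exp_ge_add_one_self[of "s * t"] by (intro mult_left_mono) auto
    finally show ?thesis .
  qed
  have "D = D powr (1 - \<theta>) * D powr \<theta>"
    using True by (simp add: powr_add[symmetric])
  also have "\<dots> \<le> (Q * p powr \<rho> * (1 + t)) powr (1 - \<theta>) * (R * exp (- c * t) / p) powr \<theta>"
    using D1 D2 True \<theta>0 \<theta>1 by (intro mult_mono powr_mono2) auto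
  also have "\<dots> = (Q powr (1 - \<theta>) * R powr \<theta>) * (1 + t) powr (1 - \<theta>) *
      (p powr (\<rho> * (1 - \<theta>)) / p powr \<theta>) * exp (- c * t) powr \<theta>"
    using p Q R t by (simp add: powr_mult powr_divide powr_powr)
  also have "p powr (\<rho> * (1 - \<theta>)) / p powr \<theta> = p powr (\<rho> / 2)"
    by (simp only: powr_diff[symmetric] split)
  also have "exp (- c * t) powr \<theta> = exp (- (2 * s * t))"
    by (simp add: powr_def s_def mult_ac)
  also have "(Q powr (1 - \<theta>) * R powr \<theta>) * (1 + t) powr (1 - \<theta>) * p powr (\<rho> / 2) * exp (- (2 * s * t))
      \<le> (Q * R) * ((1 + 1 / s) * exp (s * t)) * p powr (\<rho> / 2) * exp (- (2 * s * t))"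
  proof (intro mult_right_mono mult_mono)
    show "Q powr (1 - \<theta>) \<le> Q" using powr_mono[of "1 - \<theta>" 1 Q] Q \<theta>0 by simp
    show "R powr \<theta> \<le> R" using powr_mono[of \<theta> 1 R] R \<theta>1 by simp
    have "(1 + t) powr (1 - \<theta>) \<le> 1 + t" using powr_mono[of "1 - \<theta>" 1 "1 + t"] t \<theta>0 by simp
    then show "(1 + t) powr (1 - \<theta>) \<le> (1 + 1 / s) * exp (s * t)" using lin by linarith
  qed (use Q R in auto)
  also have "\<dots> = Q * R * (1 + 1 / s) * p powr (\<rho> / 2) * (exp (s * t) * exp (- (2 * s * t)))"
    by (simp add: mult_ac)
  also have "exp (s * t) * exp (- (2 * s * t)) = exp (- s * t)"
    by (simp add: exp_add[symmetric])
  finally show ?thesis by (simp add: s_def)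
qed

lemma add_power_le_two_power:
  fixes x y :: real
  assumes "x \<ge> 0" "y \<ge> 0"
  shows "(x + y) ^ d \<le> 2 ^ d * (x ^ d + y ^ d)"
proof -
  have "(x + y) ^ d \<le> (2 * max x y) ^ d" using assms by (intro power_mono) auto
  also have "\<dots> = 2 ^ d * max x y ^ d" by (simp add: power_mult_distrib)
  also have "max x y ^ d \<le> x ^ d + y ^ d" using assms by (auto simp: max_def)
  finally show ?thesis by simp
qed

section \<open>Choice of parameters and estimates for good patterns\<close>

context mixing_field
begin

text \<open>Chosen so that \<open>\<delta> powr return_exponent\<close> is the square root of 1 -
  \<delta>. The lower bound on pattern probabilities then keeps this power of \<open>p\<close> above
  \<open>(1 - \<delta>) powr (N / 2)\<close>.\<close>

definition return_exponent :: real where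
  "return_exponent = ln (1 - \<delta>) / (2 * ln \<delta>)"

text \<open>The fourth root splits the periodicity bound \<open>(1 - \<delta>) ^ N\<close> into four
  factors \<open>decay_base ^ N\<close>: two pay for the threshold in \<open>good\<close>, one
  absorbs polynomial volumes, and one remains as decay.\<close>

definition decay_base :: real where
  "decay_base = (1 - \<delta>) powr (1 / 4)"

text \<open>The mixing rate \<open>exp (- C\<^sub>2 m)\<close> over this gap is at most the square of any pattern
  probability.\<close>

definition gap :: "nat \<Rightarrow> nat" where
  "gap n = nat \<lceil>2 * ln (1 / \<delta>) / C\<^sub>2 * real ((n + 1) ^ CARD('d))\<rceil>"

text \<open>The threshold for Markov's inequality: given a good pattern, a near return has
  conditional probability at most \<open>p powr return_exponent\<close>.\<close>

definition good :: "nat \<Rightarrow> ('a, 'd) config set" where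
  "good n = {A \<in> patterns n.
     return_weight n (n + gap n) A \<le> prob (occurs n A 0) * prob (occurs n A 0) powr return_exponent}"

lemma return_exponent_pos: "return_exponent > 0"
  using delta_pos delta_half by (simp add: return_exponent_def divide_neg_neg)

text \<open>As \<delta> is at most 1 - \<delta>, the ratio of logarithms is at most 1. This lets
  square roots of \<open>p\<close> be replaced by \<open>p powr return_exponent\<close>.\<close>

lemma return_exponent_le: "return_exponent \<le> 1 / 2"
proof -
  have "ln \<delta> \<le> ln (1 - \<delta>)" using delta_pos delta_half by simp
  moreover have "ln \<delta> < 0" using delta_pos delta_half by simp
  ultimately show ?thesis by (simp add: return_exponent_def divide_simps)
qed

lemma decay_base_pos: "decay_base > 0" and decay_base_less_1: "decay_base < 1"
  using delta_pos delta_half powr_less_mono2[of "1 / 4" "1 - \<delta>" 1] by (auto simp: decay_base_def)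

lemma decay_base_power4: "decay_base ^ 4 = 1 - \<delta>"
  using delta_half by (simp add: decay_base_def powr_power)

lemma cylinder_le_decay_base: "prob (occurs n A 0) \<le> decay_base ^ (4 * (n + 1) ^ CARD('d))"
  using cylinder_bounds(2)[of n A] by (simp add: power_mult decay_base_power4)

lemma cylinder_powr_return_exponent:
  "decay_base ^ (2 * (n + 1) ^ CARD('d)) \<le> prob (occurs n A 0) powr return_exponent"
proof -
  define N where "N = (n + 1) ^ CARD('d)"
  have "\<delta> powr return_exponent = (1 - \<delta>) powr (1 / 2)"
    using delta_pos delta_half by (simp add: powr_def return_exponent_def)
  also have "\<dots> = decay_base ^ 2"
    using delta_half by (simp add: decay_base_def powr_power)
  finally have "(\<delta> powr return_exponent) ^ N = decay_base ^ (2 * N)"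
    by (simp only: power_mult)
  moreover have "(\<delta> ^ N) powr return_exponent = (\<delta> powr return_exponent) ^ N"
    using delta_pos by (simp add: powr_powr powr_realpow[symmetric] mult.commute)
  moreover have "(\<delta> ^ N) powr return_exponent \<le> prob (occurs n A 0) powr return_exponent"
    using cylinder_bounds(1)[of n A] return_exponent_pos delta_pos by (intro powr_mono2) (auto simp: N_def)
  ultimately show ?thesis by (simp add: N_def)
qed

lemma gap_decay: "exp (- C\<^sub>2 * real (gap n)) \<le> (prob (occurs n A 0))\<^sup>2"
proof -
  let ?N = "(n + 1) ^ CARD('d)"
  have "2 * ln (1 / \<delta>) / C\<^sub>2 * real ?N \<le> real (gap n)"
    unfolding gap_def by linarith
  then have "2 * ln (1 / \<delta>) * real ?N \<le> C\<^sub>2 * real (gap n)"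
    using C2_pos by (simp add: field_simps)
  then have "exp (- C\<^sub>2 * real (gap n)) \<le> exp (real (2 * ?N) * ln \<delta>)"
    using delta_pos by (simp add: ln_div algebra_simps)
  also have "\<dots> = (\<delta> ^ ?N)\<^sup>2"
    by (simp only: exp_of_nat_mult exp_ln[OF delta_pos] power_even_eq)
  also have "\<dots> \<le> (prob (occurs n A 0))\<^sup>2"
    using cylinder_bounds(1)[of n A] delta_pos by (intro power_mono) auto
  finally show ?thesis .
qed

text \<open>The gap is linear in \<open>N = (n + 1) ^ CARD('d)\<close>, so the cube of near sites
  has polynomial volume in \<open>N\<close>, while \<open>decay_base ^ N\<close> decays
  geometrically.\<close>

lemma volume_bound:
  "\<exists>K>0. \<forall>n. real ((n + gap n + 1) ^ CARD('d)) * decay_base ^ (n + 1) ^ CARD('d) \<le> K"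
proof -
  define \<kappa> where "\<kappa> = 2 * ln (1 / \<delta>) / C\<^sub>2"
  have \<kappa>: "\<kappa> \<ge> 0" using delta_pos delta_half C2_pos by (simp add: \<kappa>_def)
  obtain K where K: "K > 0" "\<And>N::nat. ((2 + \<kappa>) * real N) ^ CARD('d) * decay_base ^ N \<le> K"
    using power_times_geometric_bounded[OF decay_base_pos decay_base_less_1, of "2 + \<kappa>" "CARD('d)"] \<kappa> by auto
  have "real ((n + gap n + 1) ^ CARD('d)) * decay_base ^ (n + 1) ^ CARD('d) \<le> K" for n
  proof -
    define N where "N = (n + 1) ^ CARD('d)"
    have N: "n + 1 \<le> N" "1 \<le> N"
      unfolding N_def by (simp_all add: self_le_power)
    \<comment> \<open>The 1 comes from the ceiling in \<open>gap\<close>; it and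
      \<open>n + 1\<close> are absorbed by \<open>2 * N\<close>.\<close>
    have "real (gap n) \<le> \<kappa> * real N + 1"
      using mult_nonneg_nonneg[OF \<kappa>, of "real N"]
      unfolding gap_def \<kappa>_def[symmetric] N_def[symmetric] by linarith
    then have "real (n + gap n + 1) \<le> (2 + \<kappa>) * real N"
      using N by (simp add: algebra_simps)
    then have "real (n + gap n + 1) ^ CARD('d) * decay_base ^ N \<le> ((2 + \<kappa>) * real N) ^ CARD('d) * decay_base ^ N"
      using decay_base_pos by (intro mult_right_mono power_mono) auto
    also have "\<dots> \<le> K" by (rule K)
    finally show ?thesis by (simp add: N_def)
  qed
  with K(1) show ?thesis by blast
qed

text \<open>Markov's inequality over patterns: a bad pattern has probability at most its return
  weight divided by \<open>decay_base ^ (2 * N)\<close>, and the total return weight is at most a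
  polynomial volume times \<open>decay_base ^ (4 * N)\<close>.\<close>

lemma bad_patterns_bound:
  assumes K: "\<And>n. real ((n + gap n + 1) ^ CARD('d)) * decay_base ^ (n + 1) ^ CARD('d) \<le> K"
  shows "prob (\<Union>A\<in>patterns n - good n. occurs n A 0) \<le> K * decay_base ^ (n + 1) ^ CARD('d)"
proof -
  define N where "N = (n + 1) ^ CARD('d)"
  have "prob (\<Union>A\<in>patterns n - good n. occurs n A 0) \<le>
      (\<Sum>A\<in>patterns n - good n. prob (occurs n A 0))"
    using occurs_event by (intro finite_measure_subadditive_finite) auto
  also have "\<dots> \<le> (\<Sum>A\<in>patterns n - good n. return_weight n (n + gap n) A / decay_base ^ (2 * N))"
  proof (rule sum_mono)
    fix A assume "A \<in> patterns n - good n"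
    then have "prob (occurs n A 0) * prob (occurs n A 0) powr return_exponent < return_weight n (n + gap n) A"
      by (auto simp: good_def)
    moreover have "prob (occurs n A 0) * decay_base ^ (2 * N) \<le>
        prob (occurs n A 0) * prob (occurs n A 0) powr return_exponent"
      unfolding N_def by (intro mult_left_mono cylinder_powr_return_exponent) auto
    ultimately show "prob (occurs n A 0) \<le> return_weight n (n + gap n) A / decay_base ^ (2 * N)"
      using decay_base_pos by (simp add: pos_le_divide_eq)
  qed
  also have "\<dots> \<le> (\<Sum>A\<in>patterns n. return_weight n (n + gap n) A / decay_base ^ (2 * N))"
    using decay_base_pos by (intro sum_mono2) (auto simp: return_weight_def intro!: sum_nonneg divide_nonneg_nonneg)
  also have "\<dots> = (\<Sum>A\<in>patterns n. return_weight n (n + gap n) A) / decay_base ^ (2 * N)"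
    by (simp add: sum_divide_distrib)
  also have "\<dots> \<le> real ((n + gap n + 1) ^ CARD('d)) * (1 - \<delta>) ^ N / decay_base ^ (2 * N)"
    unfolding N_def using decay_base_pos by (intro divide_right_mono sum_return_weight) auto
  also have "\<dots> = real ((n + gap n + 1) ^ CARD('d)) * decay_base ^ N * decay_base ^ N"
  proof -
    have "(1 - \<delta>) ^ N = decay_base ^ (2 * N) * (decay_base ^ N * decay_base ^ N)"
      by (simp add: decay_base_power4[symmetric] power_mult[symmetric] power_add[symmetric])
    then show ?thesis using decay_base_pos by simp
  qed
  also have "\<dots> \<le> K * decay_base ^ N"
    unfolding N_def using decay_base_pos K by (intro mult_right_mono) auto
  finally show ?thesis by (simp add: N_def)
qed

text \<open>The three errors of \<open>conditional_avoidance\<close> are bounded by goodness, by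
  volume against \<open>p\<close>, and by \<open>gap_decay\<close>. Here \<mu> stands for the
  parameter of the pattern, and \<open>l\<close> is a lower bound that makes the constant
  uniform.\<close>

lemma good_pattern_conditional_avoidance:
  assumes A: "A \<in> good n" and K: "\<And>n. real ((n + gap n + 1) ^ CARD('d)) * decay_base ^ (n + 1) ^ CARD('d) \<le> K"
    and t: "t > 0" and l: "0 < l" "l \<le> \<mu>" and k: "k \<ge> 0" "k ^ CARD('d) = t / (\<mu> * prob (occurs n A 0))"
  shows "\<bar>prob (avoids n A (cube (nat \<lfloor>k\<rfloor>) - {0}) \<inter> occurs n A 0) / prob (occurs n A 0) -
      prob (avoids n A (cube (nat \<lfloor>k\<rfloor>) - {0}))\<bar> \<le>
    (1 + K + 2 ^ CARD('d) * C\<^sub>1 * (1 / l + K)) * prob (occurs n A 0) powr return_exponent * (1 + t)"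
proof -
  define p where "p = prob (occurs n A 0)"
  define q where "q = p powr return_exponent"
  define N where "N = (n + 1) ^ CARD('d)"
  define m where "m = n + gap n + 1"
  define d where "d = CARD('d)"
  have p: "0 < p" "p \<le> 1" using cylinder_pos by (simp_all add: p_def)
  have q: "q > 0" using p by (simp add: q_def)
  have root: "p powr (1 / 2) \<le> q"
    using p return_exponent_le by (simp add: q_def powr_mono')
  have root_base: "p powr (1 / 2) \<le> decay_base ^ N"
  proof -
    have "decay_base ^ (4 * N) \<le> decay_base ^ (2 * N)"
      using decay_base_pos decay_base_less_1 by (intro power_decreasing) auto
    then have "p \<le> decay_base ^ (2 * N)" using cylinder_le_decay_base[of n A] by (simp add: p_def N_def)
    also have "\<dots> = (decay_base ^ N) powr 2"
      using decay_base_pos by (simp add: power_mult[symmetric] mult.commute)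
    finally have "p powr (1 / 2) \<le> ((decay_base ^ N) powr 2) powr (1 / 2)"
      using p by (intro powr_mono2) auto
    then show ?thesis using decay_base_pos by (simp add: powr_powr)
  qed
  have p_split: "p = p powr (1 / 2) * p powr (1 / 2)"
    using p by (simp add: powr_add[symmetric])
  have pq: "p \<le> q" using powr_mono'[of return_exponent 1 p] p return_exponent_le by (simp add: q_def)
  \<comment> \<open>One square root of \<open>p\<close> pays for the volume; the other gives the
    required power.\<close>
  have vol: "real (m ^ d) * p \<le> K * q"
  proof -
    have "real (m ^ d) * p = real (m ^ d) * p powr (1 / 2) * p powr (1 / 2)"
      using p_split by simp
    also have "\<dots> \<le> real (m ^ d) * decay_base ^ N * q"
      using root root_base by (intro mult_mono) (auto simp: decay_base_pos less_imp_le)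
    also have "\<dots> \<le> K * q"
      using K[of n] q by (intro mult_right_mono) (auto simp: m_def d_def N_def)
    finally show ?thesis .
  qed
  have N: "real N * p \<le> K * q"
  proof -
    have "N \<le> m ^ d" unfolding N_def m_def d_def by (intro power_mono) auto
    then have "real N * p \<le> real (m ^ d) * p" using p by (intro mult_right_mono) auto
    then show ?thesis using vol by linarith
  qed
  \<comment> \<open>The sign of \<open>K\<close> follows from \<open>N\<close>, since
    \<open>real N * p\<close> is nonnegative and \<open>q\<close> is positive.\<close>
  have K0: "K \<ge> 0"
    using N q p by (meson mult_nonneg_nonneg of_nat_0_le_iff less_imp_le order_trans zero_le_mult_iff not_le)
  have first: "return_weight n (n + gap n) A / p \<le> q"
    using A p by (simp add: good_def p_def[symmetric] q_def[symmetric] pos_divide_le_eq mult.commute)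
  have last: "real ((nat \<lfloor>k\<rfloor> + n + 1) ^ d) * (C\<^sub>1 * exp (- C\<^sub>2 * real (gap n))) \<le>
      2 ^ d * C\<^sub>1 * (1 / l + K) * q * (1 + t)"
  proof -
    have "real (nat \<lfloor>k\<rfloor> + n + 1) \<le> k + real (n + 1)" using k(1) by simp
    then have "real (nat \<lfloor>k\<rfloor> + n + 1) ^ d \<le> (k + real (n + 1)) ^ d"
      by (intro power_mono) auto
    also have "\<dots> \<le> 2 ^ d * (k ^ d + real (n + 1) ^ d)"
      using k(1) by (intro add_power_le_two_power) auto
    also have "k ^ d + real (n + 1) ^ d = t / (\<mu> * p) + real N"
      using k(2) by (simp add: d_def p_def N_def)
    \<comment> \<open>The volume of the long cube is of order \<open>t / (\<mu> * p)\<close>; the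
      mixing factor \<open>p\<^sup>2\<close> outweighs the singular \<open>1 / p\<close> and leaves
      one power of \<open>p\<close>.\<close>
    finally have "real ((nat \<lfloor>k\<rfloor> + n + 1) ^ d) * (C\<^sub>1 * exp (- C\<^sub>2 * real (gap n))) \<le>
        (2 ^ d * (t / (\<mu> * p) + real N)) * (C\<^sub>1 * p\<^sup>2)"
      using C1_pos p t l gap_decay[of n A] unfolding p_def[symmetric]
      by (intro mult_mono) auto
    also have "\<dots> = 2 ^ d * C\<^sub>1 * (t / \<mu> * p + real N * p * p)"
      using p l by (simp add: field_simps power2_eq_square)
    also have "\<dots> \<le> 2 ^ d * C\<^sub>1 * (t / l * q + K * q)"
    proof (intro mult_left_mono add_mono)
      show "t / \<mu> * p \<le> t / l * q"
        using t l p pq by (intro mult_mono divide_left_mono) auto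
      have "real N * p * p \<le> real N * p * 1" using p by (intro mult_left_mono) auto
      then show "real N * p * p \<le> K * q" using N by linarith
    qed (use C1_pos in auto)
    also have "\<dots> \<le> 2 ^ d * C\<^sub>1 * ((1 / l + K) * q * (1 + t))"
    proof (rule mult_left_mono)
      have "0 \<le> q / l + K * q * t" using q l t K0 by simp
      moreover have "(1 / l + K) * q * (1 + t) = t / l * q + K * q + (q / l + K * q * t)"
        using l by (simp add: field_simps)
      ultimately show "t / l * q + K * q \<le> (1 / l + K) * q * (1 + t)" by linarith
    qed (use C1_pos in auto)
    finally show ?thesis by (simp add: mult.assoc)
  qed
  have "\<bar>prob (avoids n A (cube (nat \<lfloor>k\<rfloor>) - {0}) \<inter> occurs n A 0) / p -
      prob (avoids n A (cube (nat \<lfloor>k\<rfloor>) - {0}))\<bar> \<le>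
      return_weight n (n + gap n) A / p + real (m ^ d) * p +
      real ((nat \<lfloor>k\<rfloor> + n + 1) ^ d) * (C\<^sub>1 * exp (- C\<^sub>2 * real (gap n)))"
    unfolding p_def m_def d_def by (rule conditional_avoidance)
  also have "\<dots> \<le> q + K * q + 2 ^ d * C\<^sub>1 * (1 / l + K) * q * (1 + t)"
    using first vol last by linarith
  also have "\<dots> \<le> (q + K * q) * (1 + t) + 2 ^ d * C\<^sub>1 * (1 / l + K) * q * (1 + t)"
    using q K0 t by (simp add: algebra_simps)
  also have "\<dots> = (1 + K + 2 ^ d * C\<^sub>1 * (1 / l + K)) * q * (1 + t)"
    by (simp add: algebra_simps)
  finally show ?thesis by (simp add: p_def q_def d_def)
qed

end

section \<open>The exponential law for repetitions\<close>

lemma first_occurrence_lawE: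
  fixes P :: "('a::finite, 'd::finite) config measure"
  assumes "first_occurrence_law P lam \<Lambda>\<^sub>1 \<Lambda>\<^sub>2"
  obtains C c \<rho> :: real where "C > 0" "c > 0" "\<rho> > 0"
    "\<And>n A. n \<ge> 1 \<Longrightarrow> A \<in> patterns n \<Longrightarrow> \<Lambda>\<^sub>1 \<le> lam n A"
    "\<And>n A t. n \<ge> 1 \<Longrightarrow> A \<in> patterns n \<Longrightarrow> t > 0 \<Longrightarrow>
      \<bar>\<P>(\<sigma> in P. ereal_of_enat (first_occurrence n A \<sigma>) >
          ereal ((t / (lam n A * measure P (cylinder n A))) powr (1 / real CARD('d)))) - exp (- t)\<bar>
        \<le> C * measure P (cylinder n A) powr \<rho> * exp (- c * t)"
proof -
  from assms obtain C c \<rho> where "C > 0" "c > 0" "\<rho> > 0"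
    and law: "\<forall>n\<ge>1. \<forall>A\<in>patterns n. lam n A \<in> {\<Lambda>\<^sub>1..\<Lambda>\<^sub>2} \<and> (\<forall>t>0.
      \<bar>\<P>(\<sigma> in P. ereal_of_enat (first_occurrence n A \<sigma>) >
          ereal ((t / (lam n A * measure P (cylinder n A))) powr (1 / real CARD('d)))) - exp (- t)\<bar>
        \<le> C * measure P (cylinder n A) powr \<rho> * exp (- c * t))"
    unfolding first_occurrence_law_def by (elim exE conjE) (rule that)
  then show thesis
    by (intro that[of C c \<rho>]) (simp_all only: atLeastAtMost_iff)
qed

lemma repetition_event_eq:
  fixes A :: "('a::finite, 'd::finite) config"
  assumes A: "A \<in> patterns n" and k: "k \<ge> 0"
  shows "{\<sigma>. ereal_of_enat (first_repetition n \<sigma>) > ereal k \<and> \<sigma> \<in> cylinder n A} =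
    avoids n A (cube (nat \<lfloor>k\<rfloor>) - {0}) \<inter> occurs n A 0"
  using first_occurrence_gt_iff[OF A k] first_repetition_eq_first_occurrence[of _ n A]
  by (auto simp: cylinder_eq_occurs[OF A, symmetric])

section \<open>Good cylinders and assembly of the constants\<close>

context mixing_field
begin

lemma good_subset_patterns: "good n \<subseteq> patterns n"
  by (auto simp: good_def)

text \<open>Cylinders have positive probability, hence are nonempty, and a configuration determines
  its pattern. Inclusion in the union thus identifies the pattern as one of the good ones.\<close>

lemma cylinder_subset_good:
  assumes A: "A \<in> patterns n" and "cylinder n A \<subseteq> (\<Union>B\<in>good n. cylinder n B)"
  shows "A \<in> good n"
proof -
  have "occurs n A 0 \<noteq> {}" using cylinder_pos[of n A] by auto
  then obtain \<sigma> where "\<sigma> \<in> cylinder n A" by (auto simp: cylinder_eq_occurs[OF A])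
  with assms(2) show ?thesis by (auto simp: cylinder_def)
qed

lemma compl_good_eq: "- (\<Union>A\<in>good n. cylinder n A) = (\<Union>A\<in>patterns n - good n. occurs n A 0)"
proof -
  have "restrict \<sigma> (cube n) \<in> patterns n" for \<sigma> :: "('a, 'd) config"
    by (auto simp: patterns_def local_configs_def)
  then have "- (\<Union>A\<in>good n. cylinder n A) = (\<Union>A\<in>patterns n - good n. cylinder n A)"
    by (auto simp: cylinder_def)
  then show ?thesis by (simp add: cylinder_eq_occurs)
qed

lemma repetition_law:
  assumes l: "\<Lambda>\<^sub>1 > 0" and law: "first_occurrence_law P lam \<Lambda>\<^sub>1 \<Lambda>\<^sub>2"
  shows "\<exists>(G :: nat \<Rightarrow> ('a, 'd) config set) (B::real) (b::real) (C::real) (c::real) (\<rho>::real).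
    B > 0 \<and> b > 0 \<and> C > 0 \<and> c > 0 \<and> \<rho> > 0 \<and>
    (\<forall>n\<ge>1.
      (\<exists>\<G>\<subseteq>patterns n. G n = (\<Union>A\<in>\<G>. cylinder n A)) \<and>
      measure P (- G n) \<le> B * exp (- b * real n ^ CARD('d)) \<and>
      (\<forall>A\<in>patterns n. cylinder n A \<subseteq> G n \<longrightarrow>
        (\<forall>t>0.
          \<bar>\<P>(\<sigma> in P. ereal_of_enat (first_repetition n \<sigma>) >
                ereal ((t / (lam n A * measure P (cylinder n A))) powr (1 / real CARD('d)))
              \<bar> \<sigma> \<in> cylinder n A) - exp (- t)\<bar>
          \<le> C * measure P (cylinder n A) powr \<rho> * exp (- c * t))))"
proof -
  obtain C' c' \<rho>' where pos: "C' > 0" "c' > 0" "\<rho>' > 0"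
    and range: "\<And>n A. n \<ge> 1 \<Longrightarrow> A \<in> patterns n \<Longrightarrow> \<Lambda>\<^sub>1 \<le> lam n A"
    and occ: "\<And>n A t. n \<ge> 1 \<Longrightarrow> A \<in> patterns n \<Longrightarrow> t > 0 \<Longrightarrow>
      \<bar>\<P>(\<sigma> in P. ereal_of_enat (first_occurrence n A \<sigma>) >
          ereal ((t / (lam n A * measure P (cylinder n A))) powr (1 / real CARD('d)))) - exp (- t)\<bar>
        \<le> C' * measure P (cylinder n A) powr \<rho>' * exp (- c' * t)"
    using law by (rule first_occurrence_lawE) (rule that)
  obtain K where K: "K > 0"
    "\<And>n. real ((n + gap n + 1) ^ CARD('d)) * decay_base ^ (n + 1) ^ CARD('d) \<le> K"
    using volume_bound by blast
  define G where "G n = (\<Union>A\<in>good n. cylinder n A)" for n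
  define Q where "Q = 1 + K + 2 ^ CARD('d) * C\<^sub>1 * (1 / \<Lambda>\<^sub>1 + K)"
  \<comment> \<open>A common rate for the two terms \<open>exp (- t)\<close> and
    \<open>exp (- c' * t)\<close> that bound the tail of the first occurrence.\<close>
  define c\<^sub>0 where "c\<^sub>0 = min 1 c'"
  define \<theta> where "\<theta> = return_exponent / (2 * (1 + return_exponent))"
  define D where "D = Q * (1 + C') * (1 + 2 / (c\<^sub>0 * \<theta>))"
  \<comment> \<open>Two errors are added: that of passing from the conditional to the unconditional
    law, and that of the law for occurrences. The smaller rate and exponent serve both, because
    \<open>p \<le> 1\<close>.\<close>
  define c where "c = min (c\<^sub>0 * \<theta> / 2) c'"
  define \<rho> where "\<rho> = min (return_exponent / 2) \<rho>'"
  have Q: "Q \<ge> 1" using K(1) C1_pos l by (simp add: Q_def)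
  have c0: "c\<^sub>0 > 0" "c\<^sub>0 \<le> 1" "c\<^sub>0 \<le> c'" using pos by (auto simp: c\<^sub>0_def)
  have \<theta>: "\<theta> > 0" using return_exponent_pos by (simp add: \<theta>_def)
  have D: "D > 0" using Q pos c0 \<theta> by (auto simp: D_def intro!: mult_pos_pos add_pos_pos)
  have small: "measure P (- G n) \<le> K * exp (- (- ln decay_base) * real n ^ CARD('d))" for n
  proof -
    have "measure P (- G n) \<le> K * decay_base ^ (n + 1) ^ CARD('d)"
      unfolding G_def compl_good_eq by (rule bad_patterns_bound[OF K(2)])
    also have "\<dots> \<le> K * decay_base ^ n ^ CARD('d)"
      using K(1) decay_base_pos decay_base_less_1
      by (intro mult_left_mono power_decreasing power_mono) auto
    also have "decay_base ^ n ^ CARD('d) = exp (- (- ln decay_base) * real n ^ CARD('d))"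
      using decay_base_pos exp_of_nat_mult[of "n ^ CARD('d)" "ln decay_base"] by (simp add: mult.commute)
    finally show ?thesis .
  qed
  have main: "\<bar>\<P>(\<sigma> in P. ereal_of_enat (first_repetition n \<sigma>) >
          ereal ((t / (lam n A * measure P (cylinder n A))) powr (1 / real CARD('d)))
        \<bar> \<sigma> \<in> cylinder n A) - exp (- t)\<bar>
      \<le> (D + C') * measure P (cylinder n A) powr \<rho> * exp (- c * t)"
    if n: "n \<ge> 1" and A: "A \<in> patterns n" and sub: "cylinder n A \<subseteq> G n" and t: "t > 0" for n A t
  proof -
    have good: "A \<in> good n" using cylinder_subset_good[OF A] sub by (simp add: G_def)
    define p where "p = prob (occurs n A 0)"
    define k where "k = (t / (lam n A * p)) powr (1 / real CARD('d))"
    define E where "E = avoids n A (cube (nat \<lfloor>k\<rfloor>) - {0})"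
    define q where "q = prob (E \<inter> occurs n A 0) / p"
    have cyl: "measure P (cylinder n A) = p" by (simp add: cylinder_eq_occurs[OF A] p_def)
    have p: "p > 0" "p \<le> 1" using cylinder_pos by (simp_all add: p_def)
    have lam: "lam n A \<ge> \<Lambda>\<^sub>1" using range n A by blast
    have k0: "k \<ge> 0" by (simp add: k_def)
    have kd: "k ^ CARD('d) = t / (lam n A * prob (occurs n A 0))"
    proof -
      have "t / (lam n A * p) > 0" using t lam l p by simp
      moreover have "(y powr (1 / real CARD('d))) ^ CARD('d) = y" if "y > 0" for y :: real
        using that by (simp add: powr_realpow[symmetric] powr_powr)
      ultimately show ?thesis by (simp only: k_def p_def[symmetric])
    qed
    have "{\<sigma> \<in> space P. ereal_of_enat (first_repetition n \<sigma>) > ereal k \<and> \<sigma> \<in> cylinder n A} =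
        E \<inter> occurs n A 0"
      using repetition_event_eq[OF A k0] by (simp add: E_def)
    then have rep: "\<P>(\<sigma> in P. ereal_of_enat (first_repetition n \<sigma>) > ereal k \<bar> \<sigma> \<in> cylinder n A) = q"
      using cyl by (simp add: cond_prob_def q_def)
    have "\<P>(\<sigma> in P. ereal_of_enat (first_occurrence n A \<sigma>) > ereal k) = prob E"
      using first_occurrence_gt_iff[OF A k0] by (simp add: E_def)
    then have E: "\<bar>prob E - exp (- t)\<bar> \<le> C' * p powr \<rho>' * exp (- c' * t)"
      using occ[OF n A t] unfolding cyl k_def by simp
    have "\<bar>q - prob E\<bar> \<le> Q * p powr return_exponent * (1 + t)"
      using good_pattern_conditional_avoidance[OF good K(2) t l lam k0 kd]
      by (simp add: q_def E_def p_def Q_def)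
    \<comment> \<open>For large \<open>t\<close> no decoupling is used: \<open>q\<close> and
      \<open>prob E\<close> both lie between 0 and \<open>prob E / p\<close>, and
      \<open>prob E\<close> decays in \<open>t\<close> by the law for occurrences.\<close>
    moreover have "\<bar>q - prob E\<bar> \<le> (1 + C') * exp (- c\<^sub>0 * t) / p"
    proof -
      have "E \<in> events" by (simp add: E_def avoids_event)
      then have "q \<le> prob E / p"
        unfolding q_def using p by (intro divide_right_mono finite_measure_mono) auto
      moreover have "prob E \<le> prob E / p" using p by (simp add: divide_simps mult_left_le)
      moreover have "q \<ge> 0" "prob E \<ge> 0" using p by (auto simp: q_def)
      ultimately have "\<bar>q - prob E\<bar> \<le> prob E / p" by linarith
      also have "prob E \<le> (1 + C') * exp (- c\<^sub>0 * t)"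
      proof -
        have "p powr \<rho>' \<le> 1" using powr_le1[of \<rho>' p] p pos by simp
        then have "C' * p powr \<rho>' * exp (- c' * t) \<le> C' * 1 * exp (- c\<^sub>0 * t)"
          using pos c0 t by (intro mult_mono) auto
        moreover have "exp (- t) \<le> exp (- c\<^sub>0 * t)" using c0 t by simp
        ultimately have "prob E \<le> exp (- c\<^sub>0 * t) + C' * 1 * exp (- c\<^sub>0 * t)"
          using E by linarith
        then show ?thesis by (simp add: algebra_simps)
      qed
      finally show ?thesis using p by (simp add: divide_right_mono)
    qed
    ultimately have "\<bar>q - prob E\<bar> \<le> D * p powr (return_exponent / 2) * exp (- (c\<^sub>0 * \<theta> / 2) * t)"
      unfolding D_def using p return_exponent_pos c0 t Q pos \<theta>_def by (intro geometric_interpolation) auto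
    also have "\<dots> \<le> D * p powr \<rho> * exp (- c * t)"
      using D p t by (intro mult_mono powr_mono') (auto simp: \<rho>_def c_def)
    finally have 1: "\<bar>q - prob E\<bar> \<le> D * p powr \<rho> * exp (- c * t)" .
    have "C' * p powr \<rho>' * exp (- c' * t) \<le> C' * p powr \<rho> * exp (- c * t)"
      using pos p t by (intro mult_mono powr_mono') (auto simp: \<rho>_def c_def)
    with 1 E have "\<bar>q - exp (- t)\<bar> \<le> (D + C') * p powr \<rho> * exp (- c * t)"
      by (simp add: algebra_simps)
    then show ?thesis unfolding cyl k_def[symmetric] rep .
  qed
  show ?thesis
  proof (intro exI conjI allI impI)
    show "good n \<subseteq> patterns n" for n by (rule good_subset_patterns)
    show "G n = (\<Union>A\<in>good n. cylinder n A)" for n by (simp add: G_def)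
    show "K > 0" "- ln decay_base > 0" "D + C' > 0" "c > 0" "\<rho> > 0"
      using K D pos decay_base_pos decay_base_less_1 c0 \<theta> return_exponent_pos by (auto simp: c_def \<rho>_def)
  qed (use small main in auto)
qed

end

text \<open>Reading a pointwise bound off the real supremum requires its set to be bounded above.
  Each member is at most 1: two probabilities differ by at most 1, and the volume is at least
  1.\<close>

lemma gibbs_mixing_field:
  fixes P :: "('a::finite, 'd::finite) config measure"
  assumes two: "CARD('a) \<ge> 2" and U: "interaction U" and G: "gibbs_field U P"
    and mix: "exponentially_phi_mixing P"
  shows "\<exists>\<delta> C\<^sub>1 C\<^sub>2. mixing_field P \<delta> C\<^sub>1 C\<^sub>2"
proof -
  interpret prob_space P using G by (simp add: gibbs_field_def)
  obtain \<delta> where \<delta>: "\<delta> > 0"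
    "\<And>E x a. E \<in> sets (local_field (- {x})) \<Longrightarrow> \<delta> * prob E \<le> prob (E \<inter> {\<sigma>. \<sigma> x = a})"
    using gibbs_finite_energy[OF U G] by blast
  obtain C\<^sub>1 C\<^sub>2 where C: "C\<^sub>1 > 0" "C\<^sub>2 > 0"
    "\<And>m. m > 0 \<Longrightarrow> phi_mixing_coeff P m \<le> C\<^sub>1 * exp (- C\<^sub>2 * m)"
    using mix unfolding exponentially_phi_mixing_def by blast
  have sets: "sets P = sets config_space" using G by (simp add: gibbs_field_def)
  then have space: "space P = UNIV" using sets_eq_imp_space_eq by fastforce
  have cond: "\<P>(\<sigma> in P. \<sigma> \<in> E\<^sub>1 \<bar> \<sigma> \<in> E\<^sub>2) = prob (E\<^sub>1 \<inter> E\<^sub>2) / prob E\<^sub>2" for E\<^sub>1 E\<^sub>2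
    by (simp add: cond_prob_def space Int_def)
  have ev: "E \<in> events" if "E \<in> sets (local_field V)" for E V
    using that sets_local_field_subset[of V] sets by auto
  have cond_le: "\<bar>prob (E\<^sub>1 \<inter> E\<^sub>2) / prob E\<^sub>2 - prob E\<^sub>1\<bar> \<le> 1" if "E\<^sub>2 \<in> events" for E\<^sub>1 E\<^sub>2
  proof -
    have "prob (E\<^sub>1 \<inter> E\<^sub>2) \<le> prob E\<^sub>2" using that by (intro finite_measure_mono) auto
    then have "prob (E\<^sub>1 \<inter> E\<^sub>2) / prob E\<^sub>2 \<le> 1" by (simp add: divide_le_eq_1 zero_less_measure_iff)
    moreover have "prob (E\<^sub>1 \<inter> E\<^sub>2) / prob E\<^sub>2 \<ge> 0" by simp
    ultimately show ?thesis using measure_nonneg[of P E\<^sub>1] prob_le_1[of E\<^sub>1] by linarith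
  qed
  have mixing: "\<bar>prob (E\<^sub>1 \<inter> E\<^sub>2) / prob E\<^sub>2 - prob E\<^sub>1\<bar> \<le> real (card A\<^sub>1) * (C\<^sub>1 * exp (- C\<^sub>2 * m))"
    if A: "A\<^sub>1 \<in> finite_volumes" "A\<^sub>2 \<in> finite_volumes" "m > 0" "m \<le> real_of_int (volume_dist A\<^sub>1 A\<^sub>2)"
      and E: "E\<^sub>1 \<in> sets (local_field A\<^sub>1)" "E\<^sub>2 \<in> sets (local_field A\<^sub>2)" "prob E\<^sub>2 > 0"
    for A\<^sub>1 A\<^sub>2 m E\<^sub>1 E\<^sub>2
  proof -
    have card: "card A\<^sub>1 > 0" using A(1) by (auto simp: finite_volumes_def card_gt_0_iff)
    have "1 / real (card A\<^sub>1) * \<bar>prob (E\<^sub>1 \<inter> E\<^sub>2) / prob E\<^sub>2 - prob E\<^sub>1\<bar> \<le> phi_mixing_coeff P m"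
      unfolding phi_mixing_coeff_def cond
    proof (rule cSup_upper)
      show "bdd_above {1 / real (card A\<^sub>1) * \<bar>prob (E\<^sub>1 \<inter> E\<^sub>2) / prob E\<^sub>2 - prob E\<^sub>1\<bar> | A\<^sub>1 A\<^sub>2 E\<^sub>1 E\<^sub>2.
          A\<^sub>1 \<in> finite_volumes \<and> A\<^sub>2 \<in> finite_volumes \<and> m \<le> real_of_int (volume_dist A\<^sub>1 A\<^sub>2) \<and>
          E\<^sub>1 \<in> sets (local_field A\<^sub>1) \<and> E\<^sub>2 \<in> sets (local_field A\<^sub>2) \<and> prob E\<^sub>2 > 0}"
      proof (rule bdd_aboveI[of _ 1], clarify)
        fix A\<^sub>1 A\<^sub>2 :: "'d site set" and E\<^sub>1 E\<^sub>2 :: "('a, 'd) config set"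
        assume "A\<^sub>1 \<in> finite_volumes" and "E\<^sub>2 \<in> sets (local_field A\<^sub>2)"
        then have "1 / real (card A\<^sub>1) \<le> 1" "\<bar>prob (E\<^sub>1 \<inter> E\<^sub>2) / prob E\<^sub>2 - prob E\<^sub>1\<bar> \<le> 1"
          using cond_le ev by (auto simp: finite_volumes_def divide_le_eq_1 Suc_le_eq card_gt_0_iff)
        then show "1 / real (card A\<^sub>1) * \<bar>prob (E\<^sub>1 \<inter> E\<^sub>2) / prob E\<^sub>2 - prob E\<^sub>1\<bar> \<le> 1"
          by (intro mult_le_one) auto
      qed
    qed (use A E in blast)
    also have "\<dots> \<le> C\<^sub>1 * exp (- C\<^sub>2 * m)" using C(3) A(3) .
    finally show ?thesis using card by (simp add: field_simps)
  qed
  have "mixing_field P \<delta> C\<^sub>1 C\<^sub>2"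
  proof unfold_locales
    show "translation_invariant P" using G by (simp add: gibbs_field_def)
  qed (use sets two \<delta> C mixing in auto)
  then show ?thesis by blast
qed

text \<open>There is only one configuration, so every cylinder is the whole space, the conditioning
  is void, and the law for occurrences is already the claim.\<close>

lemma one_symbol_repetition_law:
  fixes P :: "('a::finite, 'd::finite) config measure"
  assumes one: "CARD('a) = 1" and P: "prob_space P" "sets P = sets config_space"
    and law: "first_occurrence_law P lam \<Lambda>\<^sub>1 \<Lambda>\<^sub>2"
  shows "\<exists>(G :: nat \<Rightarrow> ('a, 'd) config set) (B::real) (b::real) (C::real) (c::real) (\<rho>::real).
    B > 0 \<and> b > 0 \<and> C > 0 \<and> c > 0 \<and> \<rho> > 0 \<and>
    (\<forall>n\<ge>1.
      (\<exists>\<G>\<subseteq>patterns n. G n = (\<Union>A\<in>\<G>. cylinder n A)) \<and>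
      measure P (- G n) \<le> B * exp (- b * real n ^ CARD('d)) \<and>
      (\<forall>A\<in>patterns n. cylinder n A \<subseteq> G n \<longrightarrow>
        (\<forall>t>0.
          \<bar>\<P>(\<sigma> in P. ereal_of_enat (first_repetition n \<sigma>) >
                ereal ((t / (lam n A * measure P (cylinder n A))) powr (1 / real CARD('d)))
              \<bar> \<sigma> \<in> cylinder n A) - exp (- t)\<bar>
          \<le> C * measure P (cylinder n A) powr \<rho> * exp (- c * t))))"
proof -
  interpret prob_space P by fact
  have space: "space P = UNIV" using sets_eq_imp_space_eq[OF P(2)] by simp
  obtain C c \<rho> where pos: "C > 0" "c > 0" "\<rho> > 0"
    and occ: "\<And>n A t. n \<ge> 1 \<Longrightarrow> A \<in> patterns n \<Longrightarrow> t > 0 \<Longrightarrow>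
      \<bar>\<P>(\<sigma> in P. ereal_of_enat (first_occurrence n A \<sigma>) >
          ereal ((t / (lam n A * measure P (cylinder n A))) powr (1 / real CARD('d)))) - exp (- t)\<bar>
        \<le> C * measure P (cylinder n A) powr \<rho> * exp (- c * t)"
    using law by (rule first_occurrence_lawE) (rule that)
  obtain z :: 'a where z: "\<And>a :: 'a. a = z" using one by (metis UNIV_I card_1_singletonE singletonD)
  have cyl: "cylinder n A = UNIV" if "A \<in> patterns n" for n and A :: "('a, 'd) config"
  proof -
    have "\<sigma> y = A y" for \<sigma> y using z by metis
    then show ?thesis by (auto simp: cylinder_eq_occurs[OF that] occurs_def)
  qed
  have main: "\<bar>\<P>(\<sigma> in P. ereal_of_enat (first_repetition n \<sigma>) >
          ereal ((t / (lam n A * measure P (cylinder n A))) powr (1 / real CARD('d)))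
        \<bar> \<sigma> \<in> cylinder n A) - exp (- t)\<bar>
      \<le> C * measure P (cylinder n A) powr \<rho> * exp (- c * t)"
    if A: "n \<ge> 1" "A \<in> patterns n" "t > 0" for n A t
  proof -
    have "first_repetition n \<sigma> = first_occurrence n A \<sigma>" for \<sigma>
      using first_repetition_eq_first_occurrence cyl[OF A(2)] by blast
    then show ?thesis
      using occ[OF A] prob_space by (simp add: cond_prob_def cyl[OF A(2)] space)
  qed
  have UN: "(\<Union>A\<in>patterns n. cylinder n A) = (UNIV :: ('a, 'd) config set)" for n
    by (auto simp: cylinder_def patterns_def local_configs_def)
  show ?thesis
  proof (intro exI conjI allI impI)
    show "(UNIV :: ('a, 'd) config set) = (\<Union>A\<in>patterns n. cylinder n A)" for n by (simp add: UN)
    \<comment> \<open>\<open>B\<close> and \<open>b\<close> are arbitrary positive numbers here, as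
      the complement of the whole space is empty.\<close>
    show "(1 :: real) > 0" "(1 :: real) > 0" "C > 0" "c > 0" "\<rho> > 0" using pos by simp_all
  qed (use main in auto)
qed

theorem theorem2:
  fixes P :: "('a::finite, 'd::finite) config measure"
    and U :: "'d site set \<Rightarrow> ('a, 'd) config \<Rightarrow> real"
    and lam :: "nat \<Rightarrow> ('a, 'd) config \<Rightarrow> real"
    and \<Lambda>\<^sub>1 \<Lambda>\<^sub>2 :: real
  assumes "CARD('d) \<ge> 2"
    and "interaction U"
    and "gibbs_field U P"
    and "exponentially_phi_mixing P"
    and "0 < \<Lambda>\<^sub>1" and "\<Lambda>\<^sub>1 \<le> \<Lambda>\<^sub>2"
    and "first_occurrence_law P lam \<Lambda>\<^sub>1 \<Lambda>\<^sub>2"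
  shows "\<exists>(G :: nat \<Rightarrow> ('a, 'd) config set) (B::real) (b::real) (C::real) (c::real) (\<rho>::real).
    B > 0 \<and> b > 0 \<and> C > 0 \<and> c > 0 \<and> \<rho> > 0 \<and>
    (\<forall>n\<ge>1.
      (\<exists>\<G>\<subseteq>patterns n. G n = (\<Union>A\<in>\<G>. cylinder n A)) \<and>
      measure P (- G n) \<le> B * exp (- b * real n ^ CARD('d)) \<and>
      (\<forall>A\<in>patterns n. cylinder n A \<subseteq> G n \<longrightarrow>
        (\<forall>t>0.
          \<bar>\<P>(\<sigma> in P. ereal_of_enat (first_repetition n \<sigma>) >
                ereal ((t / (lam n A * measure P (cylinder n A))) powr (1 / real CARD('d)))
              \<bar> \<sigma> \<in> cylinder n A) - exp (- t)\<bar>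
          \<le> C * measure P (cylinder n A) powr \<rho> * exp (- c * t))))"
proof (cases "CARD('a) \<ge> 2")
  case True
  then obtain \<delta> C\<^sub>1 C\<^sub>2 where "mixing_field P \<delta> C\<^sub>1 C\<^sub>2"
    using gibbs_mixing_field assms(2-4) by blast
  then show ?thesis using assms(5,7) by (rule mixing_field.repetition_law)
next
  \<comment> \<open>A one-letter alphabet admits no exponential decay of pattern probabilities, so
    it is treated directly.\<close>
  case False
  moreover have "CARD('a) > 0" by (simp add: card_gt_0_iff)
  ultimately have "CARD('a) = 1" by linarith
  then show ?thesis
    using assms(3,7) by (intro one_symbol_repetition_law) (auto simp: gibbs_field_def)
qed

end
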